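(* Let $\varepsilon>0$, let $f\in C^2(\mathbb R)$, and let $u_\ell>u_r$ be real numbers. For $u\in H^2(0,1)$ set $F^\varepsilon(x;u):=\partial_xf(u(x))-\varepsilon u_{xx}(x)$ and $J^\varepsilon(u):=\frac12\int_0^1|F^\varepsilon(x;u)|^2\,dx$. There is a unique $u^*_\varepsilon\in H^2(0,1)$ with $F^\varepsilon(\cdot;u^*_\varepsilon)=0$ almost everywhere on $(0,1)$ and $u^*_\varepsilon(0)=u_\ell$, $u^*_\varepsilon(1)=u_r$. Every minimizing sequence for $J^\varepsilon$ over the set $\{u\in H^2(0,1):u(0)=u_\ell,\ u(1)=u_r\}$ converges strongly to $u^*_\varepsilon$ in $H^2(0,1)$.
   Context: A minimizing sequence is a sequence $\{u_n\}$ in the stated set with $J^\varepsilon(u_n)$ converging to the infimum of $J^\varepsilon$ over that set. *)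

theory Defs
  imports "HOL-Analysis.Analysis"
begin

(* Elements of Lebesgue and Sobolev spaces on (0,1) are represented by functions real => real;
   two functions represent the same element iff they agree almost everywhere on (0,1), and their
   values outside (0,1) are irrelevant. *)

abbreviation unit_meas :: "real measure" where
  "unit_meas \<equiv> lebesgue_on {0<..<1}"

definition C2_fun :: "(real \<Rightarrow> real) \<Rightarrow> bool" where
  "C2_fun f \<longleftrightarrow> f C1_differentiable_on UNIV \<and> deriv f C1_differentiable_on UNIV"

(* C_c^infinity(0,1), each function being extended by zero to the real line. *)
definition test_fun :: "(real \<Rightarrow> real) \<Rightarrow> bool" where
  "test_fun \<phi> \<longleftrightarrow>
     (\<forall>n x. (deriv ^^ n) \<phi> field_differentiable (at x)) \<and>
     closure {x. \<phi> x \<noteq> 0} \<subseteq> {0<..<1}"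

definition L1_loc :: "(real \<Rightarrow> real) \<Rightarrow> bool" where
  "L1_loc u \<longleftrightarrow> (\<forall>K. compact K \<and> K \<subseteq> {0<..<1} \<longrightarrow> u absolutely_integrable_on K)"

definition L2 :: "(real \<Rightarrow> real) set" where
  "L2 = {u. u \<in> borel_measurable unit_meas \<and> integrable unit_meas (\<lambda>x. (u x)\<^sup>2)}"

definition has_weak_deriv :: "(real \<Rightarrow> real) \<Rightarrow> (real \<Rightarrow> real) \<Rightarrow> bool" where
  "has_weak_deriv u g \<longleftrightarrow> L1_loc u \<and> L1_loc g \<and>
     (\<forall>\<phi>. test_fun \<phi> \<longrightarrow>
        (LINT x|unit_meas. u x * deriv \<phi> x) = - (LINT x|unit_meas. g x * \<phi> x))"

(* A representative; weak derivatives are unique only up to null sets. *)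
definition weak_deriv :: "(real \<Rightarrow> real) \<Rightarrow> real \<Rightarrow> real" where
  "weak_deriv u = (SOME g. has_weak_deriv u g)"

definition H2 :: "(real \<Rightarrow> real) set" where
  "H2 = {u. u \<in> L2 \<and> (\<exists>g\<in>L2. has_weak_deriv u g \<and> (\<exists>h\<in>L2. has_weak_deriv g h))}"

definition H2_norm :: "(real \<Rightarrow> real) \<Rightarrow> real" where
  "H2_norm u = sqrt ((LINT x|unit_meas. (u x)\<^sup>2) + (LINT x|unit_meas. (weak_deriv u x)\<^sup>2)
                   + (LINT x|unit_meas. (weak_deriv (weak_deriv u) x)\<^sup>2))"

(* The representative of u that is continuous on [0,1], which exists for u in H^2(0,1) and is
   unique on [0,1]; the boundary values u(0) and u(1) are its values. *)
definition cont_rep :: "(real \<Rightarrow> real) \<Rightarrow> real \<Rightarrow> real" where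
  "cont_rep u = (SOME v. continuous_on {0..1} v \<and> (AE x in unit_meas. v x = u x))"

definition H2_bdry :: "real \<Rightarrow> real \<Rightarrow> (real \<Rightarrow> real) set" where
  "H2_bdry ul ur = {u \<in> H2. cont_rep u 0 = ul \<and> cont_rep u 1 = ur}"

definition residual :: "(real \<Rightarrow> real) \<Rightarrow> real \<Rightarrow> (real \<Rightarrow> real) \<Rightarrow> real \<Rightarrow> real" where
  "residual f \<epsilon> u x = weak_deriv (\<lambda>y. f (u y)) x - \<epsilon> * weak_deriv (weak_deriv u) x"

definition J :: "(real \<Rightarrow> real) \<Rightarrow> real \<Rightarrow> (real \<Rightarrow> real) \<Rightarrow> real" where
  "J f \<epsilon> u = 1/2 * (LINT x|unit_meas. \<bar>residual f \<epsilon> u x\<bar>\<^sup>2)"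

definition solution :: "(real \<Rightarrow> real) \<Rightarrow> real \<Rightarrow> real \<Rightarrow> real \<Rightarrow> (real \<Rightarrow> real) \<Rightarrow> bool" where
  "solution f \<epsilon> ul ur u \<longleftrightarrow> u \<in> H2_bdry ul ur \<and> (AE x in unit_meas. residual f \<epsilon> u x = 0)"

definition minimizing_seq ::
  "((real \<Rightarrow> real) \<Rightarrow> real) \<Rightarrow> (real \<Rightarrow> real) set \<Rightarrow> (nat \<Rightarrow> real \<Rightarrow> real) \<Rightarrow> bool" where
  "minimizing_seq I A U \<longleftrightarrow> (\<forall>n. U n \<in> A) \<and> (\<lambda>n. I (U n)) \<longlonglongrightarrow> (INF u\<in>A. I u)"

end

theory Submission
  imports Defs
begin

text \<open>
  Integrating the residual once, a function \<open>u\<close> in \<open>H\<^sup>2\<close> satisfies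
  \<open>f(u) - \<epsilon> u' = k + r\<close> with a constant \<open>k\<close> and a continuous \<open>r\<close> that is bounded uniformly by the
  \<open>L\<^sup>2\<close> norm of the residual, that is by \<open>sqrt (2 J(u))\<close>.

  Existence: for \<open>k\<close> above the maximum of \<open>f\<close> on \<open>[u\<^sub>r, u\<^sub>\<ell>]\<close>, the decreasing profile of
  \<open>\<epsilon> u' = f(u) - k\<close> needs the time \<open>\<integral> \<epsilon> / (k - f(s)) ds\<close> to travel from \<open>u\<^sub>\<ell>\<close> to \<open>u\<^sub>r\<close>. This time tends to
  0 as \<open>k\<close> grows and diverges logarithmically as \<open>k\<close> decreases to the maximum, since \<open>f\<close> is
  Lipschitz, so it equals 1 for some \<open>k\<close>.

  Stability: if \<open>\<bar>r\<bar> < \<eta>\<close>, the boundary values force the constants of \<open>u\<close> and of the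
  stationary profile to differ by less than \<open>\<eta>\<close>, as otherwise the difference of the two functions could cross 0
  in one direction only. A Gronwall barrier then bounds the difference and its
  derivative by a multiple of \<open>\<eta>\<close>; the barrier stays below 1 for small \<open>\<eta>\<close>, hence a
  Lipschitz constant of \<open>f\<close> near the range of the profile is enough. The equation
  itself controls the second derivative. So the \<open>H\<^sup>2\<close> distance to the profile is at most a
  multiple of \<open>sqrt (2 J(u))\<close> when \<open>J(u)\<close> is small, which yields both uniqueness and strong convergence.
\<close>

subsection \<open>Smooth bump functions\<close>

text \<open>This is the differentiability half of \<open>test_fun\<close>. It is separated from the
  support condition because the building blocks of test functions, such as exponentials cut off at
  0, are not compactly supported themselves.\<close>

definition smooth :: "(real \<Rightarrow> real) \<Rightarrow> bool" where
  "smooth \<phi> \<longleftrightarrow> (\<forall>n x. (deriv ^^ n) \<phi> field_differentiable (at x))"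

text \<open>A coinduction principle: all iterated derivatives stay in \<open>S\<close>. It replaces
  formulas for the n-th derivative by a choice of a class that is closed under
  \<open>deriv\<close>.\<close>

lemma smoothI:
  assumes "\<phi> \<in> S" and "\<And>g x. g \<in> S \<Longrightarrow> g field_differentiable (at x)"
    and "\<And>g. g \<in> S \<Longrightarrow> deriv g \<in> S"
  shows "smooth \<phi>"
proof -
  have "(deriv ^^ n) \<phi> \<in> S" for n
    by (induction n) (auto intro: assms)
  then show ?thesis
    unfolding smooth_def using assms(2) by blast
qed

lemma smooth_imp_field_differentiable: "smooth \<phi> \<Longrightarrow> \<phi> field_differentiable (at x)"
  unfolding smooth_def by (metis funpow_0)

lemma smooth_DERIV: "smooth \<phi> \<Longrightarrow> (\<phi> has_field_derivative deriv \<phi> x) (at x)"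
  by (simp add: field_differentiable_derivI smooth_imp_field_differentiable)

lemma smooth_deriv: "smooth \<phi> \<Longrightarrow> smooth (deriv \<phi>)"
  unfolding smooth_def by (metis funpow_Suc_right o_apply)

lemma smooth_continuous_on: "smooth \<phi> \<Longrightarrow> continuous_on A \<phi>"
  by (meson DERIV_isCont continuous_at_imp_continuous_on smooth_DERIV)

lemma smooth_antiderivative:
  assumes "\<And>x. (\<Phi> has_field_derivative \<phi> x) (at x)" "smooth \<phi>"
  shows "smooth \<Phi>"
proof (rule smoothI[where S = "insert \<Phi> (Collect smooth)"])
  have "deriv \<Phi> = \<phi>"
    using assms(1) DERIV_imp_deriv by blast
  then show "deriv g \<in> insert \<Phi> (Collect smooth)" if "g \<in> insert \<Phi> (Collect smooth)" for g
    using that assms(2) smooth_deriv by auto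
  show "g field_differentiable (at x)" if "g \<in> insert \<Phi> (Collect smooth)" for g x
    using that assms(1) smooth_imp_field_differentiable by (auto simp: field_differentiable_def)
qed simp

lemma smooth_lincomb:
  assumes "smooth f" "smooth g"
  shows "smooth (\<lambda>x. a * f x + b * g x)"
proof (rule smoothI[where S = "{\<lambda>x. a * f x + b * g x | f g. smooth f \<and> smooth g}"])
  have D: "((\<lambda>x. a * p x + b * q x) has_field_derivative a * deriv p x + b * deriv q x) (at x)"
    if "smooth p" "smooth q" for p q x
    using that by (auto intro!: derivative_eq_intros smooth_DERIV)
  show "h field_differentiable (at x)"
    if "h \<in> {\<lambda>x. a * f x + b * g x | f g. smooth f \<and> smooth g}" for h x
    using that D by (auto simp: field_differentiable_def)
  show "deriv h \<in> {\<lambda>x. a * f x + b * g x | f g. smooth f \<and> smooth g}"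
    if h: "h \<in> {\<lambda>x. a * f x + b * g x | f g. smooth f \<and> smooth g}" for h
  proof -
    obtain p q where pq: "smooth p" "smooth q" "h = (\<lambda>x. a * p x + b * q x)"
      using h by blast
    have "deriv h = (\<lambda>x. a * deriv p x + b * deriv q x)"
      using D[OF pq(1,2)] pq(3) by (auto intro!: DERIV_imp_deriv)
    then show ?thesis
      using pq smooth_deriv by blast
  qed
qed (use assms in blast)

lemma smooth_affine:
  assumes "smooth f"
  shows "smooth (\<lambda>x. f (c * x + d))"
\<comment> \<open>The free factor \<open>k\<close> absorbs the power of \<open>c\<close> that the
  chain rule produces at each differentiation.\<close>
proof (rule smoothI[where S = "{\<lambda>x. k * f (c * x + d) | k f. smooth f}"])
  have D: "((\<lambda>x. k * p (c * x + d)) has_field_derivative (k * c) * deriv p (c * x + d)) (at x)"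
    if "smooth p" for k p x
    by (auto intro!: derivative_eq_intros DERIV_chain2[OF smooth_DERIV[OF that]])
  show "h field_differentiable (at x)" if "h \<in> {\<lambda>x. k * f (c * x + d) | k f. smooth f}" for h x
    using that D by (auto simp: field_differentiable_def)
  show "deriv h \<in> {\<lambda>x. k * f (c * x + d) | k f. smooth f}"
    if h: "h \<in> {\<lambda>x. k * f (c * x + d) | k f. smooth f}" for h
  proof -
    obtain k p where kp: "smooth p" "h = (\<lambda>x. k * p (c * x + d))"
      using h by blast
    have "deriv h = (\<lambda>x. (k * c) * deriv p (c * x + d))"
      using D[OF kp(1)] kp(2) by (auto intro!: DERIV_imp_deriv)
    then show ?thesis
      using kp smooth_deriv by blast
  qed
  show "(\<lambda>x. f (c * x + d)) \<in> {\<lambda>x. k * f (c * x + d) | k f. smooth f}"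
    using assms by (auto intro!: exI[where x=1] exI[where x=f])
qed

text \<open>Products of smooth functions are not closed under \<open>deriv\<close>, since Leibniz's
  rule yields sums of them; this is the smallest class with those sums, and it is closed.\<close>

inductive sum_of_products :: "(real \<Rightarrow> real) \<Rightarrow> bool" where
  prod: "smooth f \<Longrightarrow> smooth g \<Longrightarrow> sum_of_products (\<lambda>x. f x * g x)"
| add: "sum_of_products f \<Longrightarrow> sum_of_products g \<Longrightarrow> sum_of_products (\<lambda>x. f x + g x)"

lemma smooth_mult:
  assumes "smooth f" "smooth g"
  shows "smooth (\<lambda>x. f x * g x)"
proof (rule smoothI[where S = "Collect sum_of_products"])
  have D: "(\<forall>x. h field_differentiable (at x)) \<and> sum_of_products (deriv h)"
    if "sum_of_products h" for h
    using that
  proof induction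
    case (prod f g)
    have d: "((\<lambda>x. f x * g x) has_field_derivative f x * deriv g x + deriv f x * g x) (at x)" for x
      using prod by (auto intro!: derivative_eq_intros smooth_DERIV)
    then have "deriv (\<lambda>x. f x * g x) = (\<lambda>x. f x * deriv g x + deriv f x * g x)"
      by (auto intro!: DERIV_imp_deriv)
    then show ?case
      using d prod by (auto simp: field_differentiable_def intro!: sum_of_products.intros smooth_deriv)
  next
    case (add f g)
    have "((\<lambda>x. f x + g x) has_field_derivative deriv f x + deriv g x) (at x)" for x
      using add by (auto intro!: derivative_eq_intros field_differentiable_derivI)
    moreover from this have "deriv (\<lambda>x. f x + g x) = (\<lambda>x. deriv f x + deriv g x)"
      by (auto intro!: DERIV_imp_deriv)
    ultimately show ?case
      using add by (auto simp: field_differentiable_def intro!: sum_of_products.intros)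
  qed
  then show "\<And>g x. g \<in> Collect sum_of_products \<Longrightarrow> g field_differentiable (at x)"
    and "\<And>g. g \<in> Collect sum_of_products \<Longrightarrow> deriv g \<in> Collect sum_of_products"
    by auto
  show "(\<lambda>x. f x * g x) \<in> Collect sum_of_products"
    using assms by (simp add: sum_of_products.prod)
qed

text \<open>\<open>flat 1\<close> is the classical function exp(-1/t) extended by 0. The polynomial
  factor in 1/t makes the family closed under differentiation.\<close>

definition flat :: "real poly \<Rightarrow> real \<Rightarrow> real" where
  "flat p t = (if t > 0 then poly p (inverse t) * exp (- inverse t) else 0)"

lemma poly_times_exp_minus_tendsto_0: "((\<lambda>s. poly p s * exp (- s)) \<longlongrightarrow> (0::real)) at_top"
proof -
  have "((\<lambda>s. \<Sum>i\<le>degree p. coeff p i * (s ^ i / exp s)) \<longlongrightarrow> (\<Sum>i\<le>degree p. coeff p i * 0)) at_top"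
    by (intro tendsto_sum tendsto_mult tendsto_const tendsto_power_div_exp_0)
  then show ?thesis
    by (simp add: poly_altdef sum_distrib_right exp_minus divide_inverse mult.assoc)
qed

text \<open>With s = 1/t, the derivative of p(s) exp(-s) in t is s^2 (p(s) - p'(s)) exp(-s), which
  is again in the family. At 0 the exponential decay beats every polynomial.\<close>

lemma flat_DERIV:
  "(flat p has_field_derivative flat (monom 1 2 * (p - pderiv p)) t) (at t)"
proof -
  consider "t > 0" | "t < 0" | "t = 0" by linarith
  then show ?thesis
  proof cases
    case 1
    have "((\<lambda>t. poly p (inverse t) * exp (- inverse t)) has_field_derivative
           flat (monom 1 2 * (p - pderiv p)) t) (at t)"
      using 1
      by (auto intro!: derivative_eq_intros DERIV_chain2[OF poly_DERIV]
            simp: flat_def poly_monom algebra_simps power2_eq_square)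
    then show ?thesis
      by (rule has_field_derivative_transform_within_open[where S = "{0<..}"])
         (use 1 in \<open>auto simp: flat_def\<close>)
  next
    case 2
    have "((\<lambda>t. 0) has_field_derivative flat (monom 1 2 * (p - pderiv p)) t) (at t)"
      using 2 by (simp add: flat_def)
    then show ?thesis
      by (rule has_field_derivative_transform_within_open[where S = "{..<0}"])
         (use 2 in \<open>auto simp: flat_def\<close>)
  next
    case 3
    \<comment> \<open>\<open>pCons 0 p\<close> is the product of \<open>p\<close> with the
      indeterminate: it supplies the factor 1/t of the difference quotient at 0.\<close>
    have "((\<lambda>t. poly (pCons 0 p) (inverse t) * exp (- inverse t)) \<longlongrightarrow> 0) (at_right 0)"
      using filterlim_compose[OF poly_times_exp_minus_tendsto_0 filterlim_inverse_at_top_right] .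
    then have "((\<lambda>t. (flat p t - flat p 0) / (t - 0)) \<longlongrightarrow> 0) (at_right 0)"
      by (rule Lim_transform_eventually)
         (auto simp: flat_def divide_inverse eventually_at_filter)
    moreover have "((\<lambda>t. (flat p t - flat p 0) / (t - 0)) \<longlongrightarrow> 0) (at_left 0)"
      by (rule Lim_transform_eventually[OF tendsto_const])
         (auto simp: flat_def eventually_at_filter)
    ultimately show ?thesis
      using 3 by (auto simp: has_field_derivative_iff filterlim_split_at flat_def[of _ 0])
  qed
qed

lemma smooth_flat: "smooth (flat p)"
proof (rule smoothI[where S = "range flat"])
  show "g field_differentiable (at x)" if "g \<in> range flat" for g x
    using that flat_DERIV by (auto simp: field_differentiable_def)
  have "deriv (flat q) = flat (monom 1 2 * (q - pderiv q))" for q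
    using flat_DERIV by (auto intro!: DERIV_imp_deriv)
  then show "deriv g \<in> range flat" if "g \<in> range flat" for g
    using that by auto
qed simp

text \<open>The parameter \<open>k\<close> makes the flanks steeper, so that the bumps tend
  pointwise to the indicator of the open interval while staying bounded by 1 and supported in the
  closed one. No normalisation of the integral is intended.\<close>

definition bump :: "real \<Rightarrow> real \<Rightarrow> nat \<Rightarrow> real \<Rightarrow> real" where
  "bump a b k x = flat 1 (real (Suc k) * (x - a)) * flat 1 (real (Suc k) * (b - x))"

lemma bump_eq_0: "x \<notin> {a<..<b} \<Longrightarrow> bump a b k x = 0"
  by (auto simp: bump_def flat_def zero_less_mult_iff)

lemma bump_pos: "x \<in> {a<..<b} \<Longrightarrow> bump a b k x > 0"
  by (auto simp: bump_def flat_def)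

lemma abs_bump_le_1: "\<bar>bump a b k x\<bar> \<le> 1"
  unfolding bump_def abs_mult by (intro mult_le_one) (auto simp: flat_def field_simps)

lemma bump_tendsto_indicator: "(\<lambda>k. bump a b k x) \<longlonglongrightarrow> indicator {a<..<b} x"
proof (cases "x \<in> {a<..<b}")
  case True
  have *: "(\<lambda>k. flat 1 (real (Suc k) * d)) \<longlonglongrightarrow> 1" if "d > 0" for d :: real
  proof -
    have "(\<lambda>k. exp (- (inverse (real (Suc k)) * inverse d))) \<longlonglongrightarrow> exp (- (0 * inverse d))"
      by (intro tendsto_intros LIMSEQ_inverse_real_of_nat)
    then show ?thesis
      using that by (simp add: flat_def inverse_mult_distrib del: of_nat_Suc)
  qed
  show ?thesis
    unfolding bump_def using tendsto_mult[OF *[of "x - a"] *[of "b - x"]] True by simp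
qed (simp add: bump_eq_0)

lemma smooth_bump: "smooth (bump a b k)"
proof -
  have "smooth (\<lambda>x. flat 1 (real (Suc k) * x + - (real (Suc k) * a)) *
                     flat 1 (- real (Suc k) * x + real (Suc k) * b))"
    by (intro smooth_mult smooth_affine smooth_flat)
  moreover have "bump a b k = (\<lambda>x. flat 1 (real (Suc k) * x + - (real (Suc k) * a)) *
                     flat 1 (- real (Suc k) * x + real (Suc k) * b))"
    by (auto simp: bump_def algebra_simps)
  ultimately show ?thesis
    by simp
qed

section \<open>Test functions and intervals containing their support\<close>

lemma test_funI:
  assumes "smooth \<phi>" "0 < a" "b < 1" "\<And>x. x \<notin> {a..b} \<Longrightarrow> \<phi> x = 0"
  shows "test_fun \<phi>"
proof -
  have "{x. \<phi> x \<noteq> 0} \<subseteq> {a..b}"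
    using assms(4) by blast
  then have "closure {x. \<phi> x \<noteq> 0} \<subseteq> {a..b}"
    by (rule closure_minimal) simp
  also have "\<dots> \<subseteq> {0<..<1}"
    using assms by auto
  finally show ?thesis
    using assms(1) by (auto simp: test_fun_def smooth_def)
qed

lemma test_funE:
  assumes "test_fun \<phi>"
  obtains a b where "smooth \<phi>" "0 < a" "a < b" "b < 1" "\<And>x. x \<notin> {a..b} \<Longrightarrow> \<phi> x = 0"
proof -
  \<comment> \<open>The point 1/2 keeps \<open>K\<close> nonempty when the function is identically
    0.\<close>
  define K where "K = insert (1/2) (closure {x. \<phi> x \<noteq> 0})"
  have K: "K \<subseteq> {0<..<1}"
    using assms by (auto simp: test_fun_def K_def)
  have "bounded K"
    using K bounded_subset[of "{0<..<1::real}"] by simp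
  moreover have "closed K"
    by (simp add: K_def)
  ultimately have "compact K" "K \<noteq> {}"
    by (auto simp: compact_eq_bounded_closed K_def)
  obtain m where m: "m \<in> K" "\<And>x. x \<in> K \<Longrightarrow> m \<le> x"
    using compact_attains_inf[OF \<open>compact K\<close> \<open>K \<noteq> {}\<close>] by blast
  obtain M where M: "M \<in> K" "\<And>x. x \<in> K \<Longrightarrow> x \<le> M"
    using compact_attains_sup[OF \<open>compact K\<close> \<open>K \<noteq> {}\<close>] by blast
  have "m > 0" "M < 1"
    using subsetD[OF K m(1)] subsetD[OF K M(1)] by simp_all
  \<comment> \<open>The right end is moved from \<open>M\<close> halfway towards 1, so that the
    interval has positive length even if \<open>K\<close> is a single point.\<close>
  moreover have "\<phi> x = 0" if "x \<notin> {m..(M + 1) / 2}" for x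
  proof (rule ccontr)
    assume "\<phi> x \<noteq> 0"
    then have "x \<in> K"
      using closure_subset[of "{x. \<phi> x \<noteq> 0}"] by (auto simp: K_def)
    then have "m \<le> x" "x \<le> M"
      using m(2) M(2) by blast+
    then show False
      using that \<open>M < 1\<close> by auto
  qed
  moreover have "m < (M + 1) / 2"
    using m(2)[OF M(1)] \<open>M < 1\<close> by simp
  moreover have "smooth \<phi>"
    using assms by (auto simp: test_fun_def smooth_def)
  ultimately show ?thesis
    using that[of m "(M + 1) / 2"] \<open>M < 1\<close> by auto
qed

lemma test_fun_bump: "0 < a \<Longrightarrow> b < 1 \<Longrightarrow> test_fun (bump a b k)"
  by (rule test_funI[of _ a b]) (auto intro: smooth_bump bump_eq_0)

lemma deriv_eq_0_outside_Icc:
  assumes "\<And>x. x \<notin> {a..b} \<Longrightarrow> \<phi> x = (0::real)" "x \<notin> {a..b}"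
  shows "deriv \<phi> x = 0"
proof (rule DERIV_imp_deriv)
  have "((\<lambda>x. 0) has_field_derivative 0) (at x)" by simp
  then show "(\<phi> has_field_derivative 0) (at x)"
    by (rule has_field_derivative_transform_within_open[where S = "- {a..b}"])
       (use assms in auto)
qed

subsection \<open>The fundamental lemma of the calculus of variations\<close>

lemma AE_unit_iff: "(AE x in unit_meas. P x) \<longleftrightarrow> (AE x in lebesgue. x \<in> {0<..<1} \<longrightarrow> P x)"
  by (simp add: AE_restrict_space_iff)

lemma integrable_unit_iff:
  fixes u :: "real \<Rightarrow> real"
  shows "integrable unit_meas u \<longleftrightarrow> integrable lebesgue (\<lambda>x. indicator {0<..<1} x * u x)"
  by (simp add: integrable_restrict_space)

lemma integral_unit_eq:
  fixes u :: "real \<Rightarrow> real"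
  shows "integral\<^sup>L unit_meas u = integral\<^sup>L lebesgue (\<lambda>x. indicator {0<..<1} x * u x)"
  by (simp add: integral_restrict_space)

lemma absolutely_integrable_cong_AE:
  fixes u v :: "real \<Rightarrow> real"
  assumes "u absolutely_integrable_on K" "AE x in lebesgue. x \<in> K \<longrightarrow> u x = v x"
  shows "v absolutely_integrable_on K"
proof -
  have i: "integrable lebesgue (\<lambda>x. indicator K x * u x)"
    using assms(1) by (simp add: set_integrable_def)
  moreover have ae: "AE x in lebesgue. indicator K x * u x = indicator K x * v x"
    using assms(2) by eventually_elim (auto simp: indicator_def)
  moreover have "(\<lambda>x. indicator K x * v x) \<in> borel_measurable lebesgue"
    using borel_measurable_AE[OF borel_measurable_integrable[OF i] ae] .
  ultimately have "integrable lebesgue (\<lambda>x. indicator K x * v x)"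
    using integrable_cong_AE_imp by blast
  then show ?thesis
    by (simp add: set_integrable_def)
qed

lemma borel_measurable_unit_cong_AE:
  fixes u v :: "real \<Rightarrow> real"
  assumes "u \<in> borel_measurable unit_meas" "AE x in unit_meas. u x = v x"
  shows "v \<in> borel_measurable unit_meas"
proof -
  have "(\<lambda>x. u x * indicator {0<..<1} x) \<in> borel_measurable lebesgue"
    using assms(1) by (subst (asm) borel_measurable_restrict_space_iff) (auto simp: mult.commute)
  moreover have "AE x in lebesgue. u x * indicator {0<..<1} x = v x * indicator {0<..<1} x"
    using assms(2) unfolding AE_unit_iff by eventually_elim (auto simp: indicator_def)
  ultimately have "(\<lambda>x. v x * indicator {0<..<1} x) \<in> borel_measurable lebesgue"
    by (rule borel_measurable_AE)
  then show ?thesis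
    by (subst borel_measurable_restrict_space_iff) (auto simp: mult.commute)
qed

lemma integrable_unit_cong_AE:
  fixes u v :: "real \<Rightarrow> real"
  assumes "integrable unit_meas u" "AE x in unit_meas. u x = v x"
  shows "integrable unit_meas v"
  using integrable_cong_AE_imp[OF assms(1)]
    borel_measurable_unit_cong_AE[OF borel_measurable_integrable[OF assms(1)]] assms(2) by blast

lemma continuous_on_measurable_unit:
  fixes u :: "real \<Rightarrow> real"
  assumes "continuous_on {0<..<1} u"
  shows "u \<in> borel_measurable unit_meas"
  using assms by (simp add: continuous_imp_measurable_on_sets_lebesgue)

lemma finite_measure_unit: "finite_measure unit_meas"
  by (simp add: finite_measure_lebesgue_on)

lemma measure_unit: "measure unit_meas {0<..<1} = 1"
  by (simp add: measure_restrict_space)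

lemma integrable_unit_bounded:
  fixes u :: "real \<Rightarrow> real"
  assumes "u \<in> borel_measurable unit_meas" "\<And>x. x \<in> {0<..<1} \<Longrightarrow> \<bar>u x\<bar> \<le> B"
  shows "integrable unit_meas u"
proof -
  interpret finite_measure unit_meas by (rule finite_measure_unit)
  show ?thesis
    by (rule integrable_const_bound[where B = B]) (use assms in \<open>auto intro!: AE_I2\<close>)
qed

lemma continuous_on_Icc_bounded:
  fixes p :: "real \<Rightarrow> real"
  assumes "continuous_on {a..b} p"
  obtains B where "B \<ge> 0" "\<And>x. x \<in> {a..b} \<Longrightarrow> \<bar>p x\<bar> \<le> B"
proof -
  have "compact (p ` {a..b})"
    using assms compact_continuous_image by blast
  then obtain B where B: "\<forall>y\<in>p ` {a..b}. \<bar>y\<bar> \<le> B"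
    using compact_imp_bounded bounded_real by metis
  have "\<bar>p x\<bar> \<le> max B 0" if "x \<in> {a..b}" for x
    using B that by (simp add: max.coboundedI1)
  then show ?thesis
    using that[of "max B 0"] by simp
qed

lemma continuous_on_integrable_unit:
  fixes u :: "real \<Rightarrow> real"
  assumes "continuous_on {0..1} u"
  shows "integrable unit_meas u"
proof -
  obtain B where B: "\<And>x. x \<in> {0..1} \<Longrightarrow> \<bar>u x\<bar> \<le> B"
    using continuous_on_Icc_bounded[OF assms] by blast
  show ?thesis
    by (rule integrable_unit_bounded[of _ B])
       (use B assms in \<open>auto intro!: continuous_on_measurable_unit intro: continuous_on_subset\<close>)
qed

lemma integrable_imp_L1_loc:
  assumes "integrable unit_meas u"
  shows "L1_loc u"
proof -
  have "u absolutely_integrable_on {0<..<1}"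
    using assms by (simp add: integrable_unit_iff set_integrable_def)
  then show ?thesis
    unfolding L1_loc_def by (auto elim!: set_integrable_subset intro: lmeasurable_compact fmeasurableD)
qed

lemma L1_loc_cong_AE:
  assumes "L1_loc u" "AE x in unit_meas. u x = v x"
  shows "L1_loc v"
  unfolding L1_loc_def
proof (intro allI impI)
  fix K :: "real set" assume K: "compact K \<and> K \<subseteq> {0<..<1}"
  show "v absolutely_integrable_on K"
  proof (rule absolutely_integrable_cong_AE)
    show "u absolutely_integrable_on K"
      using assms(1) K by (simp add: L1_loc_def)
    show "AE x in lebesgue. x \<in> K \<longrightarrow> u x = v x"
      using assms(2) K unfolding AE_unit_iff by (auto elim!: eventually_mono)
  qed
qed

lemma L1_loc_Icc: "L1_loc w \<Longrightarrow> 0 < a \<Longrightarrow> b < 1 \<Longrightarrow> w absolutely_integrable_on {a..b}"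
  unfolding L1_loc_def by (drule spec[of _ "{a..b}"]) auto

lemma L1_loc_mult_integrable:
  assumes w: "L1_loc w" and "continuous_on UNIV \<psi>" "0 < a" "b < 1" "\<And>x. x \<notin> {a..b} \<Longrightarrow> \<psi> x = 0"
  shows "integrable unit_meas (\<lambda>x. w x * \<psi> x)"
proof -
  have c: "continuous_on {a..b} \<psi>"
    using assms(2) continuous_on_subset by blast
  have "w absolutely_integrable_on {a..b}"
    using assms L1_loc_Icc by blast
  then have "(\<lambda>x. \<psi> x * w x) absolutely_integrable_on {a..b}"
    by (intro absolutely_integrable_bounded_measurable_product_real)
       (use c in \<open>auto intro!: continuous_imp_measurable_on_sets_lebesgue
          compact_imp_bounded compact_continuous_image\<close>)
  then have "integrable lebesgue (\<lambda>x. indicator {a..b} x * (\<psi> x * w x))"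
    by (simp add: set_integrable_def)
  also have "(\<lambda>x. indicator {a..b} x * (\<psi> x * w x)) = (\<lambda>x. indicator {0<..<1} x * (w x * \<psi> x))"
    using assms by (auto simp: indicator_def fun_eq_iff)
  finally show ?thesis
    by (simp add: integrable_unit_iff)
qed

lemma L1_loc_mult_test_fun:
  assumes "L1_loc w" "test_fun \<phi>"
  shows "integrable unit_meas (\<lambda>x. w x * \<phi> x)" "integrable unit_meas (\<lambda>x. w x * deriv \<phi> x)"
proof -
  obtain a b where ab: "smooth \<phi>" "0 < a" "a < b" "b < 1" "\<And>x. x \<notin> {a..b} \<Longrightarrow> \<phi> x = 0"
    using assms(2) test_funE by blast
  show "integrable unit_meas (\<lambda>x. w x * \<phi> x)"
    by (rule L1_loc_mult_integrable[of _ _ a b]) (use assms ab smooth_continuous_on in auto)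
  have "deriv \<phi> x = 0" if "x \<notin> {a..b}" for x
    using deriv_eq_0_outside_Icc[OF ab(5) that] by simp
  then show "integrable unit_meas (\<lambda>x. w x * deriv \<phi> x)"
    by (intro L1_loc_mult_integrable[of _ _ a b])
       (use assms ab smooth_continuous_on smooth_deriv in auto)
qed

text \<open>The positive and the negative part of \<open>w\<close> are densities of two measures
  that are finite and equal on all rays. Rays determine a Borel measure, so the measures coincide,
  and densities are unique almost everywhere.\<close>

lemma integral_zero_on_rays_imp_AE_zero:
  fixes w :: "real \<Rightarrow> real"
  assumes int: "integrable lborel w"
    and zero: "\<And>x. (LINT y|lborel. indicator {x<..} y * w y) = 0"
  shows "AE x in lborel. w x = 0"
proof -
  have [measurable]: "w \<in> borel_measurable borel"
    using int by simp
  let ?p = "\<lambda>x. ennreal (w x)" and ?n = "\<lambda>x. ennreal (- w x)"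
  have emeas: "emeasure (density lborel (\<lambda>x. ennreal (f x))) {x<..}
      = ennreal (LINT y|lborel. indicator {x<..} y * max 0 (f y))"
    if f: "integrable lborel f" for f :: "real \<Rightarrow> real" and x
  proof -
    have [measurable]: "f \<in> borel_measurable borel"
      using f by simp
    have "emeasure (density lborel (\<lambda>x. ennreal (f x))) {x<..}
        = (\<integral>\<^sup>+ y. ennreal (f y) * indicator {x<..} y \<partial>lborel)"
      by (subst emeasure_density) auto
    also have "\<dots> = (\<integral>\<^sup>+ y. ennreal (indicator {x<..} y * max 0 (f y)) \<partial>lborel)"
      by (intro nn_integral_cong) (auto simp: indicator_def max_def ennreal_neg)
    also have "\<dots> = ennreal (LINT y|lborel. indicator {x<..} y * max 0 (f y))"
    proof (rule nn_integral_eq_integral)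
      have "integrable lborel (\<lambda>y. indicator {x<..} y *\<^sub>R max 0 (f y))"
        by (intro integrable_mult_indicator integrable_max) (use f in auto)
      then show "integrable lborel (\<lambda>y. indicator {x<..} y * max 0 (f y))"
        by simp
    qed auto
    finally show ?thesis .
  qed
  have "density lborel ?p = density lborel ?n"
  proof (rule measure_eqI_lessThan)
    fix x
    have i: "integrable lborel (\<lambda>y. indicator {x<..} y * max 0 (w y))"
            "integrable lborel (\<lambda>y. indicator {x<..} y * max 0 (- w y))"
      using integrable_mult_indicator[of "{x<..}" lborel "\<lambda>y. max 0 (w y)"]
        integrable_mult_indicator[of "{x<..}" lborel "\<lambda>y. max 0 (- w y)"] int by auto
    have "(LINT y|lborel. indicator {x<..} y * max 0 (w y)) - (LINT y|lborel. indicator {x<..} y * max 0 (- w y))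
        = (LINT y|lborel. indicator {x<..} y * w y)"
      unfolding Bochner_Integration.integral_diff[OF i, symmetric]
      by (intro Bochner_Integration.integral_cong) (auto simp: indicator_def max_def)
    then show "emeasure (density lborel ?p) {x<..} = emeasure (density lborel ?n) {x<..}"
      using zero[of x] int by (simp add: emeas)
    show "emeasure (density lborel ?p) {x<..} < \<infinity>"
      using int by (simp add: emeas)
  qed auto
  then have "AE x in lborel. ?p x = ?n x"
    by (intro sigma_finite_measure.density_unique[OF sigma_finite_lborel]) auto
  then show ?thesis
  proof eventually_elim
    case (elim x)
    then show ?case
      by (cases "w x \<ge> 0") (auto simp: ennreal_neg ennreal_eq_0_iff not_le dest: sym)
  qed
qed

text \<open>Reduction to the Borel case by a Borel function \<open>v\<close> that agrees with
  \<open>w\<close> almost everywhere.\<close>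

lemma integral_zero_on_rays_imp_AE_zero_lebesgue:
  fixes w :: "real \<Rightarrow> real"
  assumes int: "integrable lebesgue w"
    and zero: "\<And>x. (LINT y|lebesgue. indicator {x<..} y * w y) = 0"
  shows "AE x in lebesgue. w x = 0"
proof -
  obtain v where v[measurable]: "v \<in> borel_measurable lborel" and ae: "AE x in lborel. w x = v x"
    using completion_ex_borel_measurable_real[of w lborel] int by auto
  have vi: "integrable lborel v"
    using integrable_cong_AE_imp[OF int, of v] AE_completion[OF ae] v
    by (subst integrable_completion[symmetric]) (auto simp: eq_commute measurable_completion)
  have [measurable]: "w \<in> borel_measurable lebesgue"
    using int by simp
  have "AE x in lborel. v x = 0"
  proof (rule integral_zero_on_rays_imp_AE_zero[OF vi])
    fix x
    have "(LINT y|lborel. indicator {x<..} y * v y) = (LINT y|lebesgue. indicator {x<..} y * v y)"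
      by (subst integral_completion) auto
    also have "\<dots> = (LINT y|lebesgue. indicator {x<..} y * w y)"
    proof (rule integral_cong_AE)
      show "(\<lambda>y. indicator {x<..} y * v y) \<in> borel_measurable lebesgue"
        by (intro measurable_completion) measurable
      show "AE y in lebesgue. indicator {x<..} y * v y = indicator {x<..} y * w y"
        using AE_completion[OF ae] by eventually_elim simp
      show "(\<lambda>y. indicator {x<..} y * w y) \<in> borel_measurable lebesgue"
        by (intro borel_measurable_times borel_measurable_indicator) auto
    qed
    finally show "(LINT y|lborel. indicator {x<..} y * v y) = 0"
      using zero by simp
  qed
  then have "AE x in lborel. w x = 0"
    using ae by eventually_elim simp
  then show ?thesis
    by (rule AE_completion)
qed

text \<open>Bumps are test functions that converge to indicators of intervals, so dominated
  convergence makes the integral of \<open>w\<close> vanish over every open interval with closure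
  inside (0,1). The criterion with rays then applies on each such interval, and countably many of
  them exhaust (0,1).\<close>

lemma fundamental_lemma:
  assumes w: "L1_loc w" and zero: "\<And>\<phi>. test_fun \<phi> \<Longrightarrow> (LINT x|unit_meas. w x * \<phi> x) = 0"
  shows "AE x in unit_meas. w x = 0"
proof -
  have int: "integrable lebesgue (\<lambda>x. indicator {a<..<b} x * w x)" if "0 < a" "b < 1" for a b
  proof -
    have "w absolutely_integrable_on {a..b}"
      using w that L1_loc_Icc by blast
    then have "w absolutely_integrable_on {a<..<b}"
      by (rule set_integrable_subset) auto
    then show ?thesis
      by (simp add: set_integrable_def)
  qed
  have int0: "(LINT x|lebesgue. indicator {a<..<b} x * w x) = 0" if ab: "0 < a" "b < 1" for a b
  proof -
    have wm: "(\<lambda>x. indicator {a<..<b} x * w x) \<in> borel_measurable lebesgue"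
      using int[OF ab] by simp
    have bump_eq: "(indicator {a<..<b} x * w x) * bump a b k x = indicator {0<..<1} x * (w x * bump a b k x)" for x k
      using ab bump_eq_0[of x a b k] by (auto simp: indicator_def)
    have "(\<lambda>k. LINT x|lebesgue. (indicator {a<..<b} x * w x) * bump a b k x)
        \<longlonglongrightarrow> (LINT x|lebesgue. (indicator {a<..<b} x * w x) * indicator {a<..<b} x)"
    proof (rule integral_dominated_convergence[where w = "\<lambda>x. \<bar>indicator {a<..<b} x * w x\<bar>"])
      fix k
      have "bump a b k \<in> borel_measurable lborel"
        using borel_measurable_continuous_onI[OF smooth_continuous_on[OF smooth_bump]] by simp
      then have "bump a b k \<in> borel_measurable lebesgue"
        by (rule measurable_completion)
      then show "(\<lambda>x. (indicator {a<..<b} x * w x) * bump a b k x) \<in> borel_measurable lebesgue"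
        by (rule borel_measurable_times[OF wm])
      show "AE x in lebesgue. norm ((indicator {a<..<b} x * w x) * bump a b k x) \<le> \<bar>indicator {a<..<b} x * w x\<bar>"
        unfolding real_norm_def abs_mult[of _ "bump _ _ _ _"]
        by (intro AE_I2 mult_left_le abs_bump_le_1 abs_ge_zero)
    next
      show "AE x in lebesgue. (\<lambda>k. (indicator {a<..<b} x * w x) * bump a b k x)
          \<longlonglongrightarrow> (indicator {a<..<b} x * w x) * indicator {a<..<b} x"
        by (intro AE_I2 tendsto_mult tendsto_const bump_tendsto_indicator)
      show "(\<lambda>x. (indicator {a<..<b} x * w x) * indicator {a<..<b} x) \<in> borel_measurable lebesgue"
        by (intro borel_measurable_times wm borel_measurable_indicator) simp
      show "integrable lebesgue (\<lambda>x. \<bar>indicator {a<..<b} x * w x\<bar>)"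
        by (intro integrable_abs int ab)
    qed
    then have "(\<lambda>k. 0) \<longlonglongrightarrow> (LINT x|lebesgue. (indicator {a<..<b} x * w x) * indicator {a<..<b} x)"
      unfolding bump_eq integral_unit_eq[symmetric] zero[OF test_fun_bump[OF ab]] .
    moreover have "(\<lambda>x. (indicator {a<..<b} x * w x) * indicator {a<..<b} x) = (\<lambda>x. indicator {a<..<b} x * w x)"
      by (auto simp: indicator_def)
    ultimately show ?thesis
      by (simp add: LIMSEQ_const_iff)
  qed
  have "AE x in lebesgue. indicator {a<..<b} x * w x = 0" if ab: "0 < a" "b < 1" for a b
  proof (rule integral_zero_on_rays_imp_AE_zero_lebesgue[OF int[OF ab]])
    fix x
    \<comment> \<open>A ray cuts the interval down to another interval of the same kind, possibly an
      empty one.\<close>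
    have "(\<lambda>y. indicator {x<..} y * (indicator {a<..<b} y * w y)) = (\<lambda>y. indicator {max a x<..<b} y * w y)"
      by (auto simp: indicator_def)
    then show "(LINT y|lebesgue. indicator {x<..} y * (indicator {a<..<b} y * w y)) = 0"
      using int0[of "max a x" b] ab by simp
  qed
  then have "AE x in lebesgue. \<forall>n. indicator {1 / real (n+2)<..<1 - 1 / real (n+2)} x * w x = 0"
    by (subst AE_all_countable) auto
  then show ?thesis
    unfolding AE_unit_iff
  proof eventually_elim
    case (elim x)
    show ?case
    proof
      assume x: "x \<in> {0<..<1}"
      then obtain n where n: "inverse (real (Suc n)) < min x (1 - x)"
        using reals_Archimedean[of "min x (1 - x)"] by auto
      have "1 / real (n + 2) < inverse (real (Suc n))"
        by (simp add: field_simps)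
      then have "x \<in> {1 / real (n+2)<..<1 - 1 / real (n+2)}"
        using n by auto
      then show "w x = 0"
        using elim[rule_format, of n] by (simp add: indicator_def split: if_splits)
    qed
  qed
qed

subsection \<open>Weak derivatives and primitives\<close>

lemma integral_indicator_Icc_deriv:
  assumes "smooth \<phi>" "a \<le> b"
  shows "(LINT x|lborel. indicator {a..b} x * deriv \<phi> x) = \<phi> b - \<phi> a"
  using integral_FTC_Icc_real[OF assms(2), of \<phi> "deriv \<phi>"] assms(1)
  by (auto simp: mult.commute has_real_derivative_iff_has_vector_derivative[symmetric]
      intro: smooth_DERIV smooth_continuous_on smooth_deriv DERIV_isCont)

lemma integrable_indicator_Icc_lborel:
  fixes \<psi> :: "real \<Rightarrow> real"
  assumes "continuous_on UNIV \<psi>" "\<And>x. x \<notin> {a..b} \<Longrightarrow> \<psi> x = 0"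
  shows "integrable lborel \<psi>"
proof -
  have "integrable lborel (\<lambda>x. indicator {a..b} x *\<^sub>R \<psi> x)"
    using borel_integrable_atLeastAtMost'[of a b \<psi>] assms(1) continuous_on_subset
    by (auto simp: set_integrable_def)
  also have "(\<lambda>x. indicator {a..b} x *\<^sub>R \<psi> x) = \<psi>"
    using assms(2) by (auto simp: indicator_def fun_eq_iff)
  finally show ?thesis .
qed

text \<open>Integration by parts for a merely integrable \<open>h\<close>: Fubini exchanges the two
  integrations, and the inner integral of \<open>deriv \<phi>\<close> from y to the right of the
  support equals \<open>- \<phi> y\<close>.\<close>

lemma integral_primitive_times_deriv_lborel:
  fixes h :: "real \<Rightarrow> real"
  assumes h: "integrable lborel h" and \<phi>: "test_fun \<phi>"
  shows "(LINT x|lborel. (LINT y|lborel. indicator {..x} y * h y) * deriv \<phi> x)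
       = - (LINT y|lborel. h y * \<phi> y)"
proof -
  obtain a b where ab: "smooth \<phi>" "0 < a" "a < b" "b < 1" "\<And>x. x \<notin> {a..b} \<Longrightarrow> \<phi> x = 0"
    using \<phi> test_funE by blast
  have d0: "deriv \<phi> x = 0" if "x \<notin> {a..b}" for x
    using deriv_eq_0_outside_Icc[OF ab(5) that] .
  have cd: "continuous_on UNIV (deriv \<phi>)"
    using ab(1) smooth_continuous_on smooth_deriv by blast
  have [measurable]: "deriv \<phi> \<in> borel_measurable borel" "h \<in> borel_measurable borel"
    using cd h by (auto intro: borel_measurable_continuous_onI)
  have di: "integrable lborel (deriv \<phi>)"
    using integrable_indicator_Icc_lborel cd d0 by blast
  have "integrable (lborel \<Otimes>\<^sub>M lborel) (\<lambda>(x, y). deriv \<phi> x * h y)"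
  proof (rule lborel_pair.Fubini_integrable)
    show "integrable lborel (\<lambda>x. LINT y|lborel. norm (case (x, y) of (x, y) \<Rightarrow> deriv \<phi> x * h y))"
      using di by (simp add: abs_mult)
    show "AE x in lborel. integrable lborel (\<lambda>y. case (x, y) of (x, y) \<Rightarrow> deriv \<phi> x * h y)"
      using h by simp
  qed measurable
  then have "integrable (lborel \<Otimes>\<^sub>M lborel) (\<lambda>(x, y). indicator {..x} y * h y * deriv \<phi> x)"
  proof (rule Bochner_Integration.integrable_bound)
    \<comment> \<open>The set \<open>{..x}\<close> varies with the other coordinate; as a comparison
      of the coordinates of the pair its indicator is visibly jointly measurable.\<close>
    have "(\<lambda>p. (if snd p \<le> fst p then 1 else 0) * h (snd p) * deriv \<phi> (fst p))
        \<in> borel_measurable (lborel \<Otimes>\<^sub>M lborel)"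
      by measurable
    also have "(\<lambda>p. (if snd p \<le> fst p then 1 else 0) * h (snd p) * deriv \<phi> (fst p))
        = (\<lambda>(x, y). indicator {..x} y * h y * deriv \<phi> x)"
      by (auto simp: fun_eq_iff indicator_def)
    finally show "(\<lambda>(x, y). indicator {..x} y * h y * deriv \<phi> x)
        \<in> borel_measurable (lborel \<Otimes>\<^sub>M lborel)" .
  qed (auto intro!: AE_I2 simp: indicator_def abs_mult)
  then have "(LINT x|lborel. LINT y|lborel. indicator {..x} y * h y * deriv \<phi> x)
      = (LINT y|lborel. LINT x|lborel. indicator {..x} y * h y * deriv \<phi> x)"
    by (rule lborel_pair.Fubini_integral[symmetric])
  also have "\<dots> = (LINT y|lborel. - (h y * \<phi> y))"
  proof (rule Bochner_Integration.integral_cong)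
    fix y
    have "(LINT x|lborel. indicator {..x} y * deriv \<phi> x) = - \<phi> y"
    proof (cases "y \<le> 1")
      case True
      have "(\<lambda>x. indicator {..x} y * deriv \<phi> x) = (\<lambda>x. indicator {y..1} x * deriv \<phi> x)"
        using d0 ab by (auto simp: indicator_def fun_eq_iff)
      then show ?thesis
        using integral_indicator_Icc_deriv[OF ab(1) True] ab by simp
    next
      case False
      then have "(\<lambda>x. indicator {..x} y * deriv \<phi> x) = (\<lambda>x. 0)"
        using d0 ab by (auto simp: indicator_def fun_eq_iff)
      then show ?thesis
        using False ab by simp
    qed
    then have "h y * (LINT x|lborel. indicator {..x} y * deriv \<phi> x) = - (h y * \<phi> y)"
      by simp
    then show "(LINT x|lborel. indicator {..x} y * h y * deriv \<phi> x) = - (h y * \<phi> y)"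
      by (subst (asm) integral_mult_right_zero[symmetric]) (simp add: ac_simps)
  qed simp
  finally show ?thesis
    by simp
qed

text \<open>The bridge between the gauge integral, used for primitives and the fundamental theorem,
  and the Lebesgue integral, used for Fubini. The two integrands can differ at the single point
  \<open>x\<close>, a null set.\<close>

lemma integral_eq_LINT_lebesgue:
  fixes g :: "real \<Rightarrow> real"
  assumes g: "integrable unit_meas g" and x: "x \<in> {0..1}"
  shows "g integrable_on {0..x}"
    and "integral {0..x} g = (LINT y|lebesgue. indicator {..x} y * (indicator {0<..<1} y * g y))"
proof -
  have "g absolutely_integrable_on {0<..<1}"
    using g by (simp add: integrable_unit_iff set_integrable_def)
  then have s: "g absolutely_integrable_on {0<..<x}"
    by (rule set_integrable_subset) (use x in auto)
  show "g integrable_on {0..x}"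
    using set_lebesgue_integral_eq_integral(1)[OF s] by (simp add: integrable_on_open_interval_real)
  have "integral {0..x} g = (LINT y:{0<..<x}|lebesgue. g y)"
    using set_lebesgue_integral_eq_integral(2)[OF s] by (simp add: integral_open_interval_real)
  also have "\<dots> = (LINT y|lebesgue. indicator {..x} y * (indicator {0<..<1} y * g y))"
    unfolding set_lebesgue_integral_def
  proof (rule integral_cong_AE)
    show "(\<lambda>y. indicator {0<..<x} y *\<^sub>R g y) \<in> borel_measurable lebesgue"
      using s by (simp add: set_integrable_def)
    have "integrable lebesgue (\<lambda>y. indicator {..x} y *\<^sub>R (indicator {0<..<1} y * g y))"
      using g by (intro integrable_mult_indicator) (auto simp: integrable_unit_iff)
    then show "(\<lambda>y. indicator {..x} y * (indicator {0<..<1} y * g y)) \<in> borel_measurable lebesgue"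
      by simp
    have "AE y in lebesgue. y \<noteq> x"
      by (rule AE_completion) (rule AE_lborel_singleton)
    then show "AE y in lebesgue. indicator {0<..<x} y *\<^sub>R g y
        = indicator {..x} y * (indicator {0<..<1} y * g y)"
      by eventually_elim (use x in \<open>auto simp: indicator_def\<close>)
  qed
  finally show "integral {0..x} g = (LINT y|lebesgue. indicator {..x} y * (indicator {0<..<1} y * g y))" .
qed

lemma continuous_on_primitive:
  assumes "integrable unit_meas g"
  shows "continuous_on {0..1} (\<lambda>x. integral {0..x} g :: real)"
  using assms by (intro indefinite_integral_continuous_1 integral_eq_LINT_lebesgue(1)) auto

text \<open>\<open>g\<close> is only Lebesgue measurable on (0,1). A Borel function \<open>v\<close>
  equal almost everywhere to its extension by 0 has the same primitive on [0,1], which brings the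
  claim back to the Borel measure.\<close>

lemma integral_primitive_times_deriv:
  assumes g: "integrable unit_meas g" and \<phi>: "test_fun \<phi>"
  shows "(LINT x|unit_meas. integral {0..x} g * deriv \<phi> x) = - (LINT x|unit_meas. g x * \<phi> x)"
proof -
  obtain a b where ab: "smooth \<phi>" "0 < a" "a < b" "b < 1" "\<And>x. x \<notin> {a..b} \<Longrightarrow> \<phi> x = 0"
    using \<phi> test_funE by blast
  have d0: "deriv \<phi> x = 0" if "x \<notin> {a..b}" for x
    using deriv_eq_0_outside_Icc[OF ab(5) that] .
  let ?w = "\<lambda>x. indicator {0<..<1} x * g x"
  have w: "integrable lebesgue ?w"
    using g by (simp add: integrable_unit_iff)
  obtain v where v[measurable]: "v \<in> borel_measurable lborel" and ae: "AE x in lborel. ?w x = v x"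
    using completion_ex_borel_measurable_real[of ?w lborel] w by auto
  have ae': "AE x in lebesgue. ?w x = v x"
    using ae by (rule AE_completion)
  have vi': "integrable lebesgue v"
    using integrable_cong_AE_imp[OF w measurable_completion[OF v] ae'] .
  then have vi: "integrable lborel v"
    by (simp add: integrable_completion)
  have prim: "integral {0..x} g = (LINT y|lborel. indicator {..x} y * v y)" if x: "x \<in> {0..1}" for x
  proof -
    have "integral {0..x} g = (LINT y|lebesgue. indicator {..x} y * v y)"
      unfolding integral_eq_LINT_lebesgue(2)[OF g x]
    proof (rule integral_cong_AE)
      show "(\<lambda>y. indicator {..x} y * ?w y) \<in> borel_measurable lebesgue"
        using integrable_mult_indicator[OF _ w, of "{..x}"] by simp
      show "(\<lambda>y. indicator {..x} y * v y) \<in> borel_measurable lebesgue"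
        using integrable_mult_indicator[OF _ vi', of "{..x}"] by simp
      show "AE y in lebesgue. indicator {..x} y * ?w y = indicator {..x} y * v y"
        using ae' by eventually_elim simp
    qed
    also have "\<dots> = (LINT y|lborel. indicator {..x} y * v y)"
      by (rule integral_completion) measurable
    finally show ?thesis .
  qed
  have cd: "continuous_on UNIV (deriv \<phi>)" and c: "continuous_on UNIV \<phi>"
    using ab(1) smooth_continuous_on smooth_deriv by blast+
  have [measurable]: "deriv \<phi> \<in> borel_measurable borel" "\<phi> \<in> borel_measurable borel"
    using cd c by (auto intro: borel_measurable_continuous_onI)
  have "(LINT x|unit_meas. integral {0..x} g * deriv \<phi> x)
      = (LINT x|lebesgue. (LINT y|lborel. indicator {..x} y * v y) * deriv \<phi> x)"
    unfolding integral_unit_eq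
    by (rule Bochner_Integration.integral_cong) (use prim d0 ab in \<open>auto simp: indicator_def\<close>)
  also have "\<dots> = (LINT x|lborel. (LINT y|lborel. indicator {..x} y * v y) * deriv \<phi> x)"
  proof (rule integral_completion)
    have "(\<lambda>x. LINT y|lborel. (if y \<le> x then 1 else 0) * v y) \<in> borel_measurable lborel"
      by measurable
    moreover have "(\<lambda>x. LINT y|lborel. (if y \<le> x then 1 else 0) * v y)
        = (\<lambda>x. LINT y|lborel. indicator {..x} y * v y)"
      by (auto simp: fun_eq_iff indicator_def intro!: Bochner_Integration.integral_cong)
    ultimately show "(\<lambda>x. (LINT y|lborel. indicator {..x} y * v y) * deriv \<phi> x) \<in> borel_measurable lborel"
      by simp
  qed
  also have "\<dots> = - (LINT y|lborel. v y * \<phi> y)"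
    using integral_primitive_times_deriv_lborel[OF vi \<phi>] .
  also have "(LINT y|lborel. v y * \<phi> y) = (LINT y|lebesgue. v y * \<phi> y)"
    by (rule integral_completion[symmetric]) measurable
  also have "\<dots> = (LINT y|lebesgue. ?w y * \<phi> y)"
  proof (rule integral_cong_AE)
    have pl: "\<phi> \<in> borel_measurable lebesgue"
      by (rule measurable_completion) simp
    show "(\<lambda>y. v y * \<phi> y) \<in> borel_measurable lebesgue" "(\<lambda>y. ?w y * \<phi> y) \<in> borel_measurable lebesgue"
      using w vi' pl by (auto intro!: borel_measurable_times)
    show "AE y in lebesgue. v y * \<phi> y = ?w y * \<phi> y"
      using ae' by eventually_elim simp
  qed
  also have "\<dots> = (LINT y|unit_meas. g y * \<phi> y)"
    by (simp add: integral_unit_eq mult.assoc)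
  finally show ?thesis .
qed

lemma LINT_unit_test_fun_deriv: "test_fun \<phi> \<Longrightarrow> (LINT x|unit_meas. deriv \<phi> x) = 0"
proof -
  assume "test_fun \<phi>"
  then obtain a b where ab: "smooth \<phi>" "0 < a" "a < b" "b < 1" "\<And>x. x \<notin> {a..b} \<Longrightarrow> \<phi> x = 0"
    using test_funE by blast
  have d0: "deriv \<phi> x = 0" if "x \<notin> {a..b}" for x
    using deriv_eq_0_outside_Icc[OF ab(5) that] .
  have nz: "0 < x \<and> x < 1" if "deriv \<phi> x \<noteq> 0" for x
    using that d0[of x] ab(2-4) by (cases "x \<in> {a..b}") auto
  have "(LINT x|unit_meas. deriv \<phi> x) = (LINT x|lebesgue. indicator {0..1} x * deriv \<phi> x)"
    unfolding integral_unit_eq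
    by (rule Bochner_Integration.integral_cong) (use nz in \<open>auto simp: indicator_def\<close>)
  also have "\<dots> = (LINT x|lborel. indicator {0..1} x * deriv \<phi> x)"
  proof (rule integral_completion)
    have [measurable]: "deriv \<phi> \<in> borel_measurable borel"
      using ab(1) by (auto intro!: borel_measurable_continuous_onI smooth_continuous_on smooth_deriv)
    show "(\<lambda>x. indicator {0..1} x * deriv \<phi> x) \<in> borel_measurable lborel"
      by measurable
  qed
  also have "\<dots> = 0"
    using integral_indicator_Icc_deriv[OF ab(1), of 0 1] ab by simp
  finally show ?thesis .
qed

text \<open>The constant drops out because the derivative of a test function has integral 0; the
  primitive is handled by the integration by parts above.\<close>

lemma has_weak_deriv_primitive:
  assumes g: "integrable unit_meas g" and u: "\<And>x. x \<in> {0<..<1} \<Longrightarrow> u x = c + integral {0..x} g"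
  shows "has_weak_deriv u g"
proof -
  have "integrable unit_meas (\<lambda>x. c + integral {0..x} g)"
    by (intro continuous_on_integrable_unit continuous_intros continuous_on_primitive g)
  then have "integrable unit_meas u"
    by (rule integrable_unit_cong_AE) (use u in \<open>auto intro!: AE_I2\<close>)
  moreover have "(LINT x|unit_meas. u x * deriv \<phi> x) = - (LINT x|unit_meas. g x * \<phi> x)"
    if \<phi>: "test_fun \<phi>" for \<phi>
  proof -
    have "(LINT x|unit_meas. u x * deriv \<phi> x)
        = (LINT x|unit_meas. c * deriv \<phi> x + integral {0..x} g * deriv \<phi> x)"
      by (rule Bochner_Integration.integral_cong) (use u in \<open>auto simp: algebra_simps\<close>)
    also have "\<dots> = (LINT x|unit_meas. c * deriv \<phi> x) + (LINT x|unit_meas. integral {0..x} g * deriv \<phi> x)"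
    proof (rule Bochner_Integration.integral_add)
      show "integrable unit_meas (\<lambda>x. c * deriv \<phi> x)"
        by (intro L1_loc_mult_test_fun(2)[OF _ \<phi>] integrable_imp_L1_loc continuous_on_integrable_unit)
           simp
      show "integrable unit_meas (\<lambda>x. integral {0..x} g * deriv \<phi> x)"
        by (intro L1_loc_mult_test_fun(2)[OF _ \<phi>] integrable_imp_L1_loc
            continuous_on_integrable_unit continuous_on_primitive g)
    qed
    also have "\<dots> = - (LINT x|unit_meas. g x * \<phi> x)"
      using integral_primitive_times_deriv[OF g \<phi>] LINT_unit_test_fun_deriv[OF \<phi>] by simp
    finally show ?thesis .
  qed
  ultimately show ?thesis
    using g by (auto simp: has_weak_deriv_def integrable_imp_L1_loc)
qed

section \<open>Linearity and uniqueness of weak derivatives\<close>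

lemma LINT_unit_test_fun_cong_AE:
  assumes "AE x in unit_meas. u x = v x" "L1_loc u" "test_fun \<phi>"
  shows "(LINT x|unit_meas. u x * \<phi> x) = (LINT x|unit_meas. v x * \<phi> x)"
    and "(LINT x|unit_meas. u x * deriv \<phi> x) = (LINT x|unit_meas. v x * deriv \<phi> x)"
proof -
  note L = L1_loc_mult_test_fun[OF assms(2,3)]
    L1_loc_mult_test_fun[OF L1_loc_cong_AE[OF assms(2,1)] assms(3)]
  show "(LINT x|unit_meas. u x * \<phi> x) = (LINT x|unit_meas. v x * \<phi> x)"
    using L assms(1) by (intro integral_cong_AE) auto
  show "(LINT x|unit_meas. u x * deriv \<phi> x) = (LINT x|unit_meas. v x * deriv \<phi> x)"
    using L assms(1) by (intro integral_cong_AE) auto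
qed

lemma has_weak_deriv_cong_AE:
  assumes "has_weak_deriv u g" "AE x in unit_meas. u x = v x" "AE x in unit_meas. g x = h x"
  shows "has_weak_deriv v h"
proof -
  have "(LINT x|unit_meas. v x * deriv \<phi> x) = - (LINT x|unit_meas. h x * \<phi> x)" if \<phi>: "test_fun \<phi>" for \<phi>
    using assms \<phi> LINT_unit_test_fun_cong_AE(2)[OF assms(2) _ \<phi>] LINT_unit_test_fun_cong_AE(1)[OF assms(3) _ \<phi>]
    by (simp add: has_weak_deriv_def)
  then show ?thesis
    using assms L1_loc_cong_AE by (auto simp: has_weak_deriv_def)
qed

lemma L1_loc_lincomb:
  assumes "L1_loc u" "L1_loc v"
  shows "L1_loc (\<lambda>x. u x + c * v x)"
  using assms unfolding L1_loc_def by (auto intro!: set_integral_add(1) set_integrable_mult_right)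

lemma has_weak_deriv_lincomb:
  assumes "has_weak_deriv u g" "has_weak_deriv v h"
  shows "has_weak_deriv (\<lambda>x. u x + c * v x) (\<lambda>x. g x + c * h x)"
proof -
  have L: "L1_loc u" "L1_loc v" "L1_loc g" "L1_loc h"
    using assms by (auto simp: has_weak_deriv_def)
  have "(LINT x|unit_meas. (u x + c * v x) * deriv \<phi> x) = - (LINT x|unit_meas. (g x + c * h x) * \<phi> x)"
    if \<phi>: "test_fun \<phi>" for \<phi>
  proof -
    have "(LINT x|unit_meas. (u x + c * v x) * deriv \<phi> x)
        = (LINT x|unit_meas. u x * deriv \<phi> x) + c * (LINT x|unit_meas. v x * deriv \<phi> x)"
      using L[THEN L1_loc_mult_test_fun(2)[OF _ \<phi>]] by (simp add: distrib_right mult.assoc)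
    moreover have "(LINT x|unit_meas. (g x + c * h x) * \<phi> x)
        = (LINT x|unit_meas. g x * \<phi> x) + c * (LINT x|unit_meas. h x * \<phi> x)"
      using L[THEN L1_loc_mult_test_fun(1)[OF _ \<phi>]] by (simp add: distrib_right mult.assoc)
    ultimately show ?thesis
      using assms \<phi> by (simp add: has_weak_deriv_def algebra_simps)
  qed
  then show ?thesis
    using L by (simp add: has_weak_deriv_def L1_loc_lincomb)
qed

lemma has_weak_deriv_unique:
  assumes "has_weak_deriv u g" "has_weak_deriv u h"
  shows "AE x in unit_meas. g x = h x"
proof -
  have L: "L1_loc g" "L1_loc h"
    using assms by (auto simp: has_weak_deriv_def)
  have "AE x in unit_meas. g x + (-1) * h x = 0"
  proof (rule fundamental_lemma)
    show "L1_loc (\<lambda>x. g x + (-1) * h x)"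
      using L L1_loc_lincomb by blast
    show "(LINT x|unit_meas. (g x + (-1) * h x) * \<phi> x) = 0" if \<phi>: "test_fun \<phi>" for \<phi>
    proof -
      have "(LINT x|unit_meas. g x * \<phi> x) = (LINT x|unit_meas. h x * \<phi> x)"
        using assms \<phi> by (simp add: has_weak_deriv_def)
      then show ?thesis
        using L[THEN L1_loc_mult_test_fun(1)[OF _ \<phi>]] by (simp add: left_diff_distrib)
    qed
  qed
  then show ?thesis
    by eventually_elim simp
qed

text \<open>The lemma of du Bois-Reymond. Subtracting a multiple of one fixed bump
  \<open>\<beta>\<close> turns any test function into the derivative of a test function, against
  which \<open>u\<close> integrates to 0. Hence \<open>u\<close> acts on every test function as the
  constant \<open>c\<close> does, and the fundamental lemma applies.\<close>

lemma has_weak_deriv_zero_imp_AE_const: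
  assumes "has_weak_deriv u (\<lambda>_. 0)"
  shows "\<exists>c. AE x in unit_meas. u x = c"
proof -
  have L: "L1_loc u"
    using assms by (simp add: has_weak_deriv_def)
  define \<beta> where "\<beta> = bump (1/4) (3/4) 0"
  have \<beta>: "test_fun \<beta>"
    unfolding \<beta>_def by (rule test_fun_bump) auto
  have one: "L1_loc (\<lambda>_. 1)"
    by (intro integrable_imp_L1_loc continuous_on_integrable_unit) simp
  have int: "integrable unit_meas \<phi>" if "test_fun \<phi>" for \<phi>
    using L1_loc_mult_test_fun(1)[OF one that] by simp
  define m where "m = (LINT x|unit_meas. \<beta> x)"
  have "m \<noteq> 0"
  proof
    assume "m = 0"
    moreover have "AE x in unit_meas. 0 \<le> \<beta> x"
    proof (rule AE_I2)
      show "0 \<le> \<beta> x" for x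
        using bump_pos[of x "1/4" "3/4" 0] bump_eq_0[of x "1/4" "3/4" 0]
        by (cases "x \<in> {1/4<..<3/4}") (simp_all add: \<beta>_def)
    qed
    ultimately have "AE x in unit_meas. \<beta> x = 0"
      using integral_nonneg_eq_0_iff_AE[OF int[OF \<beta>]] by (simp add: m_def)
    then have "AE x in unit_meas. x \<notin> {1/4<..<3/4}"
    proof eventually_elim
      case (elim x)
      then show ?case
        using bump_pos[of x "1/4" "3/4" 0] by (auto simp: \<beta>_def)
    qed
    then have "AE x in lebesgue. x \<notin> {1/4<..<3/4::real}"
      unfolding AE_unit_iff by eventually_elim auto
    then have "emeasure lebesgue {1/4<..<3/4::real} = 0"
      by (subst (asm) AE_iff_measurable[of "{1/4<..<3/4}"]) auto
    then show False
      by simp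
  qed
  define c where "c = (LINT x|unit_meas. u x * \<beta> x) / m"
  have "AE x in unit_meas. u x + (- c) * 1 = 0"
  proof (rule fundamental_lemma)
    show "L1_loc (\<lambda>x. u x + (- c) * 1)"
      using L one by (rule L1_loc_lincomb)
    fix \<phi> assume \<phi>: "test_fun \<phi>"
    \<comment> \<open>\<open>\<theta>\<close> below has mean 0, so it is the derivative of the test function \<open>\<Phi>\<close>.\<close>
    define k where "k = (LINT x|unit_meas. \<phi> x) / m"
    define \<theta> where "\<theta> = (\<lambda>x. \<phi> x + (- k) * \<beta> x)"
    obtain a b where ab: "smooth \<phi>" "0 < a" "a < b" "b < 1" "\<And>x. x \<notin> {a..b} \<Longrightarrow> \<phi> x = 0"
      using \<phi> test_funE by blast
    define a' b' where "a' = min a (1/4)" and "b' = max b (3/4)"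
    have ab': "0 < a'" "a' < b'" "b' < 1"
      using ab by (auto simp: a'_def b'_def)
    have \<theta>0: "\<theta> x = 0" if "x \<notin> {a'..b'}" for x
    proof -
      have "x \<notin> {a..b}" "x \<notin> {1/4<..<3/4}"
        using that by (auto simp: a'_def b'_def min_def max_def split: if_splits)
      then show ?thesis
        using ab(5) bump_eq_0 by (simp add: \<theta>_def \<beta>_def)
    qed
    have s\<theta>: "smooth \<theta>"
      unfolding \<theta>_def using smooth_lincomb[OF ab(1), of \<beta> 1 "-k"] smooth_bump by (simp add: \<beta>_def)
    have c\<theta>: "continuous_on S \<theta>" for S
      using s\<theta> smooth_continuous_on by blast
    have i\<theta>: "integral {0..1} \<theta> = 0"
    proof -
      have "integral {0..1} \<theta> = (LINT x|unit_meas. \<theta> x)"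
        using lebesgue_integral_eq_integral[OF continuous_on_integrable_unit[OF c\<theta>]]
        by (simp add: integral_open_interval_real)
      also have "\<dots> = (LINT x|unit_meas. \<phi> x) + (- k) * m"
        unfolding \<theta>_def m_def using int[OF \<phi>] int[OF \<beta>] by simp
      also have "\<dots> = 0"
        using \<open>m \<noteq> 0\<close> by (simp add: k_def)
      finally show ?thesis .
    qed
    \<comment> \<open>Starting at -1, to the left of the support, makes \<open>\<Phi>\<close>
      differentiable at every point above -1. On the negative half-line \<open>\<Phi>\<close> is
      identically 0, also below -1 where the interval is empty.\<close>
    define \<Phi> where "\<Phi> x = integral {-1..x} \<theta>" for x
    have D: "(\<Phi> has_field_derivative \<theta> x) (at x)" for x
    proof (cases "x > -1")
      case True
      have "(\<Phi> has_field_derivative \<theta> x) (at x within {-1..x+1})"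
        unfolding \<Phi>_def by (rule integral_has_real_derivative) (use True c\<theta> in auto)
      then show ?thesis
        using True at_within_Icc_at[of "-1" x "x+1"] by simp
    next
      case False
      have "((\<lambda>x. 0) has_field_derivative \<theta> x) (at x)"
        using False \<theta>0[of x] ab' by simp
      then show ?thesis
      proof (rule has_field_derivative_transform_within_open[where S = "{..<0}"])
        show "0 = \<Phi> y" if "y \<in> {..<0}" for y
          unfolding \<Phi>_def using that \<theta>0 ab'
          by (subst integral_cong[where g = "\<lambda>_. 0"]) auto
      qed (use False in auto)
    qed
    have \<Phi>0: "\<Phi> x = 0" if "x \<notin> {a'..b'}" for x
    proof (cases "x < a'")
      case True
      then show ?thesis
        unfolding \<Phi>_def using \<theta>0 by (subst integral_cong[where g = "\<lambda>_. 0"]) auto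
    next
      case False
      then have x: "x > b'"
        using that by auto
      have "\<Phi> x = integral {-1..0} \<theta> + integral {0..x} \<theta>"
        unfolding \<Phi>_def using x ab'
        by (intro Henstock_Kurzweil_Integration.integral_combine[symmetric] integrable_continuous_interval c\<theta>) auto
      also have "integral {-1..0} \<theta> = 0"
        using \<theta>0 ab' by (subst integral_cong[where g = "\<lambda>_. 0"]) auto
      also have "integral {0..x} \<theta> = integral {0..b'} \<theta> + integral {b'..x} \<theta>"
        using x ab' by (intro Henstock_Kurzweil_Integration.integral_combine[symmetric] integrable_continuous_interval c\<theta>) auto
      also have "integral {b'..x} \<theta> = 0"
        using integral_spike[of "{b'}" "{b'..x}" "\<lambda>_. 0" \<theta>] \<theta>0 by auto
      also have "integral {0..b'} \<theta> = integral {0..b'} \<theta> + integral {b'..1} \<theta>"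
        using integral_spike[of "{b'}" "{b'..1}" "\<lambda>_. 0" \<theta>] \<theta>0 by auto
      also have "\<dots> = integral {0..1} \<theta>"
        using ab' by (intro Henstock_Kurzweil_Integration.integral_combine integrable_continuous_interval c\<theta>) auto
      finally show ?thesis
        using i\<theta> by simp
    qed
    have t\<Phi>: "test_fun \<Phi>"
      using test_funI[OF smooth_antiderivative[OF D s\<theta>] ab'(1,3) \<Phi>0] .
    have "deriv \<Phi> = \<theta>"
      using D DERIV_imp_deriv by blast
    then have "(LINT x|unit_meas. u x * \<theta> x) = 0"
      using assms t\<Phi> by (auto simp: has_weak_deriv_def)
    moreover have "(LINT x|unit_meas. u x * \<theta> x)
        = (LINT x|unit_meas. u x * \<phi> x) + (- k) * (LINT x|unit_meas. u x * \<beta> x)"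
      using L1_loc_mult_test_fun(1)[OF L \<phi>] L1_loc_mult_test_fun(1)[OF L \<beta>]
      by (simp add: \<theta>_def algebra_simps)
    ultimately have "(LINT x|unit_meas. u x * \<phi> x) = k * (LINT x|unit_meas. u x * \<beta> x)"
      by simp
    also have "\<dots> = c * (LINT x|unit_meas. \<phi> x)"
      by (simp add: k_def c_def)
    finally show "(LINT x|unit_meas. (u x + (- c) * 1) * \<phi> x) = 0"
      using L1_loc_mult_test_fun(1)[OF L \<phi>] int[OF \<phi>] by (simp add: left_diff_distrib)
  qed
  then have "AE x in unit_meas. u x = c"
    by eventually_elim simp
  then show ?thesis ..
qed

text \<open>Subtracting the primitive of \<open>g\<close> leaves a function with weak derivative 0,
  hence a constant.\<close>

lemma has_weak_deriv_imp_primitive: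
  assumes "has_weak_deriv u g" "integrable unit_meas g"
  shows "\<exists>c. AE x in unit_meas. u x = c + integral {0..x} g"
proof -
  have "has_weak_deriv (\<lambda>x. integral {0..x} g) g"
    by (rule has_weak_deriv_primitive[OF assms(2), of _ 0]) simp
  then have "has_weak_deriv (\<lambda>x. u x + (-1) * integral {0..x} g) (\<lambda>x. g x + (-1) * g x)"
    using assms(1) has_weak_deriv_lincomb by blast
  then obtain c where "AE x in unit_meas. u x + (-1) * integral {0..x} g = c"
    using has_weak_deriv_zero_imp_AE_const[of "\<lambda>x. u x + (-1) * integral {0..x} g"] by auto
  then have "AE x in unit_meas. u x = c + integral {0..x} g"
    by eventually_elim simp
  then show ?thesis ..
qed

text \<open>\<open>weak_deriv\<close> picks an arbitrary representative; uniqueness makes this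
  choice harmless up to null sets.\<close>

lemma weak_deriv_AE_eq:
  assumes "has_weak_deriv u g"
  shows "AE x in unit_meas. weak_deriv u x = g x"
proof (rule has_weak_deriv_unique)
  show "has_weak_deriv u (weak_deriv u)"
    unfolding weak_deriv_def using someI[of "has_weak_deriv u", OF assms] .
qed (rule assms)

subsection \<open>Representatives of H2 functions\<close>

lemma L2_imp_integrable:
  assumes "u \<in> L2"
  shows "integrable unit_meas u"
proof (rule Bochner_Integration.integrable_bound)
  show "integrable unit_meas (\<lambda>x. 1 + (u x)\<^sup>2)"
    using assms continuous_on_integrable_unit[of "\<lambda>_. 1"]
    by (intro Bochner_Integration.integrable_add) (auto simp: L2_def)
  show "AE x in unit_meas. norm (u x) \<le> norm (1 + (u x)\<^sup>2)"
  proof (rule AE_I2)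
    fix x
    have "0 \<le> (\<bar>u x\<bar> - 1)\<^sup>2" by simp
    then show "norm (u x) \<le> norm (1 + (u x)\<^sup>2)"
      by (simp add: power2_diff)
  qed
qed (use assms in \<open>auto simp: L2_def\<close>)

lemma continuous_on_L2:
  assumes "continuous_on {0..1} u"
  shows "u \<in> L2"
  using assms by (auto simp: L2_def intro!: continuous_on_integrable_unit continuous_on_measurable_unit
      continuous_intros intro: continuous_on_subset)

lemma L2_lincomb:
  assumes "u \<in> L2" "v \<in> L2"
  shows "(\<lambda>x. u x + c * v x) \<in> L2"
proof -
  have m: "(\<lambda>x. u x + c * v x) \<in> borel_measurable unit_meas"
    using assms by (auto simp: L2_def)
  have "integrable unit_meas (\<lambda>x. (u x + c * v x)\<^sup>2)"
  proof (rule Bochner_Integration.integrable_bound)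
    show "integrable unit_meas (\<lambda>x. 2 * (u x)\<^sup>2 + 2 * c\<^sup>2 * (v x)\<^sup>2)"
      using assms by (auto simp: L2_def)
    show "(\<lambda>x. (u x + c * v x)\<^sup>2) \<in> borel_measurable unit_meas"
      using m by measurable
    show "AE x in unit_meas. norm ((u x + c * v x)\<^sup>2) \<le> norm (2 * (u x)\<^sup>2 + 2 * c\<^sup>2 * (v x)\<^sup>2)"
    proof (rule AE_I2)
      fix x
      have "0 \<le> (u x - c * v x)\<^sup>2" by simp
      then have "(u x + c * v x)\<^sup>2 \<le> 2 * (u x)\<^sup>2 + 2 * c\<^sup>2 * (v x)\<^sup>2"
        by (simp add: power2_eq_square algebra_simps)
      then show "norm ((u x + c * v x)\<^sup>2) \<le> norm (2 * (u x)\<^sup>2 + 2 * c\<^sup>2 * (v x)\<^sup>2)"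
        by simp
    qed
  qed
  then show ?thesis
    using m by (simp add: L2_def)
qed

lemma L2_cong_AE:
  assumes "u \<in> L2" "AE x in unit_meas. u x = v x"
  shows "v \<in> L2"
proof -
  have "AE x in unit_meas. (u x)\<^sup>2 = (v x)\<^sup>2"
    using assms(2) by eventually_elim simp
  then show ?thesis
    using assms borel_measurable_unit_cong_AE[of u v] integrable_unit_cong_AE[of "\<lambda>x. (u x)\<^sup>2" "\<lambda>x. (v x)\<^sup>2"]
    by (auto simp: L2_def)
qed

lemma LINT_unit_power2_cong_AE:
  assumes "AE x in unit_meas. u x = v x" "v \<in> L2"
  shows "(LINT x|unit_meas. (u x)\<^sup>2) = (LINT x|unit_meas. (v x :: real)\<^sup>2)"
proof (rule integral_cong_AE)
  have "u \<in> L2"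
    by (rule L2_cong_AE[OF assms(2)]) (use assms(1) in \<open>auto simp: eq_commute\<close>)
  then show "(\<lambda>x. (u x)\<^sup>2) \<in> borel_measurable unit_meas" "(\<lambda>x. (v x)\<^sup>2) \<in> borel_measurable unit_meas"
    using assms by (auto simp: L2_def)
  show "AE x in unit_meas. (u x)\<^sup>2 = (v x)\<^sup>2"
    using assms(1) by eventually_elim simp
qed

lemma LINT_unit_const: "(LINT x|unit_meas. c) = (c::real)"
  using measure_unit by (simp add: space_restrict_space)

text \<open>The Cauchy-Schwarz inequality on a space of measure 1, read off from the nonnegative
  variance of the absolute value of \<open>u\<close>.\<close>

lemma L2_abs_integral_power2_le:
  assumes "u \<in> L2"
  shows "(LINT x|unit_meas. \<bar>u x\<bar>)\<^sup>2 \<le> (LINT x|unit_meas. (u x)\<^sup>2)"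
proof -
  define m where "m = (LINT x|unit_meas. \<bar>u x\<bar>)"
  have i: "integrable unit_meas (\<lambda>x. \<bar>u x\<bar>)" "integrable unit_meas (\<lambda>x. (u x)\<^sup>2)"
    "integrable unit_meas (\<lambda>x. m\<^sup>2)"
    using L2_imp_integrable[OF assms] assms continuous_on_integrable_unit[of "\<lambda>_. m\<^sup>2"]
    by (simp_all add: L2_def)
  have "0 \<le> (LINT x|unit_meas. (\<bar>u x\<bar> - m)\<^sup>2)"
    by simp
  also have "\<dots> = (LINT x|unit_meas. (u x)\<^sup>2 - 2 * m * \<bar>u x\<bar> + m\<^sup>2)"
    by (simp add: power2_diff algebra_simps)
  also have "\<dots> = (LINT x|unit_meas. (u x)\<^sup>2) - 2 * m * m + m\<^sup>2"
    using i LINT_unit_const[of "m\<^sup>2"] by (simp add: m_def[symmetric])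
  finally show ?thesis
    by (simp add: m_def power2_eq_square)
qed

text \<open>A pointwise model of an H^2 function with its first two derivatives on the closed
  interval: \<open>v\<close> is continuously differentiable with derivative \<open>g\<close>, and
  \<open>g\<close> is absolutely continuous with density \<open>h\<close>. Classical calculus,
  boundary values included, then replaces the choice operators.\<close>

definition H2_triple :: "(real \<Rightarrow> real) \<Rightarrow> (real \<Rightarrow> real) \<Rightarrow> (real \<Rightarrow> real) \<Rightarrow> bool" where
  "H2_triple v g h \<longleftrightarrow> h \<in> L2 \<and> (\<forall>x\<in>{0..1}. g x = g 0 + integral {0..x} h)
     \<and> (\<forall>x\<in>{0..1}. v x = v 0 + integral {0..x} g)"

lemma H2_tripleD:
  assumes "H2_triple v g h"
  shows "continuous_on {0..1} g" "continuous_on {0..1} v" "g \<in> L2" "v \<in> L2" "h \<in> L2"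
    and "\<And>x. x \<in> {0..1} \<Longrightarrow> (v has_real_derivative g x) (at x within {0..1})"
    and "has_weak_deriv v g" "has_weak_deriv g h"
proof -
  have h: "integrable unit_meas h" and hL: "h \<in> L2"
    and g: "\<And>x. x \<in> {0..1} \<Longrightarrow> g x = g 0 + integral {0..x} h"
    and v: "\<And>x. x \<in> {0..1} \<Longrightarrow> v x = v 0 + integral {0..x} g"
    using assms L2_imp_integrable unfolding H2_triple_def by blast+
  have "continuous_on {0..1} (\<lambda>x. g 0 + integral {0..x} h)"
    by (intro continuous_intros continuous_on_primitive h)
  then show cg: "continuous_on {0..1} g"
    by (rule continuous_on_eq) (metis g)
  have D: "((\<lambda>x. v 0 + integral {0..x} g) has_real_derivative g x) (at x within {0..1})"
    if "x \<in> {0..1}" for x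
    using integral_has_real_derivative[OF cg that] by (auto intro!: derivative_eq_intros)
  show D': "(v has_real_derivative g x) (at x within {0..1})" if "x \<in> {0..1}" for x
    by (rule has_field_derivative_transform_within[OF D[OF that] zero_less_one that]) (metis v)
  show cv: "continuous_on {0..1} v"
    using D' DERIV_continuous_on by blast
  show "g \<in> L2" "v \<in> L2" "h \<in> L2"
    using cg cv hL continuous_on_L2 by auto
  show "has_weak_deriv v g"
    by (rule has_weak_deriv_primitive[OF continuous_on_integrable_unit[OF cg] v]) simp
  show "has_weak_deriv g h"
    by (rule has_weak_deriv_primitive[OF h g]) simp
qed

text \<open>The second weak derivative is integrated twice. The first integration replaces
  \<open>g0\<close> by its continuous representative, so that the second one starts from an exact
  primitive.\<close>

lemma H2_obtain_triple:
  assumes "u \<in> H2"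
  obtains v g h where "H2_triple v g h" "AE x in unit_meas. u x = v x"
proof -
  obtain g0 h where gh: "h \<in> L2" "g0 \<in> L2" "has_weak_deriv u g0" "has_weak_deriv g0 h"
    using assms by (auto simp: H2_def)
  obtain c where c: "AE x in unit_meas. g0 x = c + integral {0..x} h"
    using has_weak_deriv_imp_primitive[OF gh(4) L2_imp_integrable[OF gh(1)]] by blast
  define g where "g x = c + integral {0..x} h" for x
  have cg: "continuous_on {0..1} g"
    unfolding g_def by (intro continuous_intros continuous_on_primitive L2_imp_integrable gh)
  have "has_weak_deriv u g"
    by (rule has_weak_deriv_cong_AE[OF gh(3)]) (use c in \<open>auto simp: g_def\<close>)
  then obtain d where d: "AE x in unit_meas. u x = d + integral {0..x} g"
    using has_weak_deriv_imp_primitive continuous_on_integrable_unit[OF cg] by blast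
  define v where "v x = d + integral {0..x} g" for x
  have "H2_triple v g h"
    using gh by (simp add: H2_triple_def v_def g_def)
  moreover have "AE x in unit_meas. u x = v x"
    using d by (simp add: v_def)
  ultimately show ?thesis
    using that by blast
qed

text \<open>A nonnegative continuous function with integral 0 vanishes everywhere, at the endpoints
  too; this makes the boundary values well defined.\<close>

lemma continuous_on_eq_if_AE_eq:
  fixes v w :: "real \<Rightarrow> real"
  assumes "continuous_on {0..1} v" "continuous_on {0..1} w" "AE x in unit_meas. v x = w x"
    and "x \<in> {0..1}"
  shows "v x = w x"
proof -
  have c: "continuous_on {0..1} (\<lambda>x. \<bar>v x - w x\<bar>)"
    using assms by (intro continuous_intros)
  have "integral {0..1} (\<lambda>x. \<bar>v x - w x\<bar>) = (LINT x|unit_meas. \<bar>v x - w x\<bar>)"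
    using lebesgue_integral_eq_integral[OF continuous_on_integrable_unit[OF c]]
    by (simp add: integral_open_interval_real)
  also have "\<dots> = 0"
    using assms(3) by (intro integral_eq_zero_AE) auto
  finally have "\<bar>v x - w x\<bar> = 0"
    using integral_eq_0_iff[of 0 1 "\<lambda>x. \<bar>v x - w x\<bar>"] c assms(4) by auto
  then show ?thesis
    by simp
qed

text \<open>The dictionary from the arbitrary choices in \<open>cont_rep\<close> and
  \<open>weak_deriv\<close> to the concrete components of a triple.\<close>

lemma H2_triple_rep:
  assumes t: "H2_triple v g h" and ae: "AE x in unit_meas. u x = v x"
  shows "u \<in> H2" and "\<And>x. x \<in> {0..1} \<Longrightarrow> cont_rep u x = v x"
    and "AE x in unit_meas. weak_deriv u x = g x"
    and "AE x in unit_meas. weak_deriv (weak_deriv u) x = h x"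
proof -
  note T = H2_tripleD[OF t]
  have ae': "AE x in unit_meas. v x = u x"
    using ae by eventually_elim simp
  have u: "has_weak_deriv u g"
    using has_weak_deriv_cong_AE[OF T(7) ae'] by simp
  show "u \<in> H2"
    using u T L2_cong_AE[OF T(4) ae'] by (auto simp: H2_def)
  show wu: "AE x in unit_meas. weak_deriv u x = g x"
    using weak_deriv_AE_eq[OF u] .
  then have "AE x in unit_meas. g x = weak_deriv u x"
    by eventually_elim simp
  then have "has_weak_deriv (weak_deriv u) h"
    using has_weak_deriv_cong_AE[OF T(8)] by simp
  then show "AE x in unit_meas. weak_deriv (weak_deriv u) x = h x"
    by (rule weak_deriv_AE_eq)
  fix x :: real assume x: "x \<in> {0..1}"
  have c: "continuous_on {0..1} (cont_rep u) \<and> (AE x in unit_meas. cont_rep u x = u x)"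
    unfolding cont_rep_def
    by (rule someI[where P = "\<lambda>w. continuous_on {0..1} w \<and> (AE x in unit_meas. w x = u x)" and x = v])
       (intro conjI T(2) ae')
  then have "AE x in unit_meas. cont_rep u x = u x" ..
  then have "AE x in unit_meas. cont_rep u x = v x"
    using ae by eventually_elim simp
  with c show "cont_rep u x = v x"
    using continuous_on_eq_if_AE_eq[OF _ T(2) _ x] by blast
qed

lemma H2_triple_diff:
  assumes t: "H2_triple v g h" "H2_triple v' g' h'"
  shows "H2_triple (\<lambda>x. v x - v' x) (\<lambda>x. g x - g' x) (\<lambda>x. h x - h' x)"
proof -
  have *: "p integrable_on {0..x}" if "integrable unit_meas p" "x \<in> {0..1}" for p :: "real \<Rightarrow> real" and x
    using that by (rule integral_eq_LINT_lebesgue(1))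
  have "(\<lambda>x. h x + (-1) * h' x) \<in> L2"
    using t[THEN H2_tripleD(5)] by (rule L2_lincomb)
  then have L: "(\<lambda>x. h x - h' x) \<in> L2"
    by simp
  have d: "integral {0..x} (\<lambda>x. h x - h' x) = integral {0..x} h - integral {0..x} h'"
    "integral {0..x} (\<lambda>x. g x - g' x) = integral {0..x} g - integral {0..x} g'" if "x \<in> {0..1}" for x
    using t[THEN H2_tripleD(5), THEN L2_imp_integrable, THEN *[OF _ that]]
      t[THEN H2_tripleD(3), THEN L2_imp_integrable, THEN *[OF _ that]]
    by (simp_all add: Henstock_Kurzweil_Integration.integral_diff)
  have e: "g x = g 0 + integral {0..x} h" "g' x = g' 0 + integral {0..x} h'"
    "v x = v 0 + integral {0..x} g" "v' x = v' 0 + integral {0..x} g'" if "x \<in> {0..1}" for x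
    using t that unfolding H2_triple_def by blast+
  have "g x - g' x = g 0 - g' 0 + integral {0..x} (\<lambda>x. h x - h' x)"
    "v x - v' x = v 0 - v' 0 + integral {0..x} (\<lambda>x. g x - g' x)" if "x \<in> {0..1}" for x
    using d[OF that] e[OF that] by linarith+
  then show ?thesis
    unfolding H2_triple_def using L by blast
qed

section \<open>The residual and its first integral\<close>

lemma C2_funD:
  assumes "C2_fun f"
  shows "\<And>x. (f has_real_derivative deriv f x) (at x)" "continuous_on S (deriv f)" "continuous_on S f"
proof -
  have "f differentiable (at x)" "deriv f differentiable (at x)" for x
    using assms by (auto simp: C2_fun_def C1_differentiable_on_eq)
  then show D: "\<And>x. (f has_real_derivative deriv f x) (at x)" and "continuous_on S (deriv f)"
    by (auto simp: real_differentiable_def DERIV_deriv_iff_real_differentiable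
        intro!: continuous_at_imp_continuous_on differentiable_imp_continuous_within)
  show "continuous_on S f"
    using D DERIV_isCont continuous_at_imp_continuous_on by blast
qed

text \<open>Since \<open>v\<close> is continuously differentiable, the chain rule for
  \<open>f\<close> after \<open>v\<close> holds classically and gives the weak derivative. The last
  claim is the integrated equation: its integral term is the perturbation that a small
  \<open>J\<close> keeps small.\<close>

lemma H2_triple_residual:
  fixes \<epsilon> :: real
  assumes t: "H2_triple v g h" and ae: "AE x in unit_meas. u x = v x" and f: "C2_fun f"
  defines "F \<equiv> \<lambda>x. deriv f (v x) * g x - \<epsilon> * h x"
  shows "F \<in> L2" and "AE x in unit_meas. residual f \<epsilon> u x = F x"
    and "J f \<epsilon> u = 1/2 * (LINT x|unit_meas. (F x)\<^sup>2)"
    and "\<And>x. x \<in> {0..1} \<Longrightarrow> f (v x) - \<epsilon> * g x = f (v 0) - \<epsilon> * g 0 + integral {0..x} F"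
proof -
  note T = H2_tripleD[OF t] and fD = C2_funD[OF f]
  have ae': "AE x in unit_meas. v x = u x"
    using ae by eventually_elim simp
  have "continuous_on {0..1} (\<lambda>x. deriv f (v x))"
    by (rule continuous_on_compose2[OF fD(2) T(2)]) auto
  then have cp: "continuous_on {0..1} (\<lambda>x. deriv f (v x) * g x)"
    using T(1) by (intro continuous_intros)
  have ftc: "((\<lambda>x. deriv f (v x) * g x) has_integral (f (v x) - f (v 0))) {0..x}" if x: "x \<in> {0..1}" for x
  proof (rule fundamental_theorem_of_calculus)
    fix y assume y: "y \<in> {0..x}"
    have "((\<lambda>x. f (v x)) has_real_derivative deriv f (v y) * g y) (at y within {0..1})"
      using DERIV_chain2[OF fD(1) T(6), of y] x y by auto
    then show "((\<lambda>x. f (v x)) has_vector_derivative deriv f (v y) * g y) (at y within {0..x})"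
      using x by (auto simp: has_real_derivative_iff_has_vector_derivative
          intro: has_vector_derivative_within_subset)
  qed (use x in auto)
  have fv: "f (v x) = f (v 0) + integral {0..x} (\<lambda>x. deriv f (v x) * g x)" if "x \<in> {0..1}" for x
    using integral_unique[OF ftc[OF that]] by simp
  have "(\<lambda>x. deriv f (v x) * g x + (- \<epsilon>) * h x) \<in> L2"
    by (intro L2_lincomb continuous_on_L2 cp T(5))
  then show FL: "F \<in> L2"
    by (simp add: F_def)
  have "has_weak_deriv (\<lambda>x. f (v x)) (\<lambda>x. deriv f (v x) * g x)"
    by (rule has_weak_deriv_primitive[OF continuous_on_integrable_unit[OF cp] fv]) simp
  then have "has_weak_deriv (\<lambda>x. f (u x)) (\<lambda>x. deriv f (v x) * g x)"
    by (rule has_weak_deriv_cong_AE) (use ae' in \<open>auto elim: eventually_mono\<close>)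
  from weak_deriv_AE_eq[OF this] H2_triple_rep(4)[OF t ae]
  show r: "AE x in unit_meas. residual f \<epsilon> u x = F x"
    by eventually_elim (simp add: residual_def F_def)
  show "J f \<epsilon> u = 1/2 * (LINT x|unit_meas. (F x)\<^sup>2)"
    using LINT_unit_power2_cong_AE[OF r FL] by (simp add: J_def)
  fix x :: real assume x: "x \<in> {0..1}"
  have "integral {0..x} F = integral {0..x} (\<lambda>x. deriv f (v x) * g x) - \<epsilon> * integral {0..x} h"
    unfolding F_def
    using integral_eq_LINT_lebesgue(1)[OF L2_imp_integrable[OF T(5)] x] ftc[OF x]
    by (subst Henstock_Kurzweil_Integration.integral_diff) (auto intro!: integrable_on_mult_right)
  moreover have "g x = g 0 + integral {0..x} h"
    using t x unfolding H2_triple_def by blast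
  ultimately show "f (v x) - \<epsilon> * g x = f (v 0) - \<epsilon> * g 0 + integral {0..x} F"
    using fv[OF x] by (simp add: algebra_simps)
qed

lemma abs_integral_le_L2:
  assumes "F \<in> L2" "x \<in> {0..1}"
  shows "\<bar>integral {0..x} F\<bar> \<le> sqrt (LINT x|unit_meas. (F x)\<^sup>2)"
proof -
  have i: "integrable unit_meas F"
    using assms L2_imp_integrable by blast
  have F: "integrable lebesgue (\<lambda>y. indicator {..x} y * (indicator {0<..<1} y * F y))"
    using integrable_mult_indicator[of "{..x}" lebesgue "\<lambda>y. indicator {0<..<1} y * F y"] i
    by (simp add: integrable_unit_iff)
  have "\<bar>integral {0..x} F\<bar> \<le> (LINT y|lebesgue. \<bar>indicator {..x} y * (indicator {0<..<1} y * F y)\<bar>)"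
    unfolding integral_eq_LINT_lebesgue(2)[OF i assms(2)] by (rule integral_abs_bound)
  also have "\<dots> \<le> (LINT y|lebesgue. indicator {0<..<1} y * \<bar>F y\<bar>)"
  proof (rule integral_mono)
    show "integrable lebesgue (\<lambda>y. \<bar>indicator {..x} y * (indicator {0<..<1} y * F y)\<bar>)"
      using F by (rule integrable_abs)
    show "integrable lebesgue (\<lambda>y. indicator {0<..<1} y * \<bar>F y\<bar>)"
      using integrable_abs[OF i] by (simp add: integrable_unit_iff)
  qed (auto simp: indicator_def)
  also have "\<dots> = (LINT y|unit_meas. \<bar>F y\<bar>)"
    by (simp add: integral_unit_eq)
  also have "\<dots> \<le> sqrt (LINT x|unit_meas. (F x)\<^sup>2)"
    using L2_abs_integral_power2_le[OF assms(1)] by (rule real_le_rsqrt)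
  finally show ?thesis .
qed

subsection \<open>Stability of the integrated equation\<close>

text \<open>At the first point where \<open>d\<close> is nonnegative it equals 0 and has negative
  slope, so it is already positive slightly to the left, contradicting that this point is the
  first.\<close>

lemma negative_if_decreasing_at_zeros:
  fixes d d' :: "real \<Rightarrow> real"
  assumes D: "\<And>x. x \<in> {a..b} \<Longrightarrow> (d has_real_derivative d' x) (at x within {a..b})"
    and "d a < 0" and dec: "\<And>x. x \<in> {a..b} \<Longrightarrow> d x = 0 \<Longrightarrow> d' x < 0"
    and y: "y \<in> {a..b}"
  shows "d y < 0"
proof (rule ccontr)
  assume "\<not> d y < 0"
  have c: "continuous_on {a..b} d"
    using D DERIV_continuous_on by blast
  define S where "S = {a..b} \<inter> d -` {0..}"
  have "closed S"
    unfolding S_def by (intro continuous_closed_preimage c) auto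
  moreover have "S \<subseteq> {a..b}"
    by (auto simp: S_def)
  ultimately have "compact S"
    using compact_Icc by (metis closed_Int_compact inf.absorb_iff1 inf.commute)
  moreover have "y \<in> S"
    using y \<open>\<not> d y < 0\<close> by (auto simp: S_def)
  ultimately obtain t where t: "t \<in> S" "\<And>x. x \<in> S \<Longrightarrow> t \<le> x"
    using compact_attains_inf[of S] by blast
  have neg: "d x < 0" if "x \<in> {a..<t}" for x
    using that t(2)[of x] t(1) by (force simp: S_def)
  have ta: "a < t" "t \<in> {a..b}" "d t \<ge> 0"
    using t(1) assms(2) by (auto simp: S_def less_le)
  have "d t = 0"
  proof (rule ccontr)
    assume "d t \<noteq> 0"
    then obtain x where "a \<le> x" "x \<le> t" "d x = 0"
      using IVT'[of d a 0 t] assms(2) ta continuous_on_subset[OF c] by auto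
    then show False
      using neg[of x] \<open>d t \<noteq> 0\<close> by (cases "x = t") auto
  qed
  then have "d' t < 0"
    using dec ta by blast
  then obtain e where e: "e > 0" "\<And>h. h > 0 \<Longrightarrow> t - h \<in> {a..b} \<Longrightarrow> h < e \<Longrightarrow> d t < d (t - h)"
    using has_real_derivative_neg_dec_left[OF D[OF ta(2)]] by blast
  define h where "h = min (e / 2) (t - a)"
  have h: "h > 0" "h < e" "t - h \<in> {a..<t}" "t - h \<in> {a..b}"
    using e(1) ta by (auto simp: h_def min_def)
  then show False
    using e(2)[of h] neg[of "t - h"] \<open>d t = 0\<close> by simp
qed

text \<open>The positive slope at 0 makes \<open>w\<close> positive at some \<open>t\<close> shortly
  after; from there on the preceding lemma, applied to \<open>- w\<close>, excludes a return to
  0.\<close>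

lemma positive_if_increasing_at_zeros:
  fixes w w' :: "real \<Rightarrow> real"
  assumes D: "\<And>x. x \<in> {0..1} \<Longrightarrow> (w has_real_derivative w' x) (at x within {0..1})"
    and "w 0 = 0" and inc: "\<And>x. x \<in> {0..1} \<Longrightarrow> w x = 0 \<Longrightarrow> w' x > 0"
  shows "w 1 > 0"
proof -
  have "w' 0 > 0"
    using inc[of 0] assms(2) by simp
  then obtain e where e: "e > 0" "\<And>h. h > 0 \<Longrightarrow> 0 + h \<in> {0..1} \<Longrightarrow> h < e \<Longrightarrow> w 0 < w (0 + h)"
    using has_real_derivative_pos_inc_right[OF D[of 0]] by auto
  define t where "t = min (e / 2) (1 / 2)"
  have t: "0 < t" "t < e" "t < 1"
    using e(1) by (auto simp: t_def)
  then have "w t > 0"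
    using e(2)[of t] assms(2) by simp
  have "- w 1 < 0"
  proof (rule negative_if_decreasing_at_zeros[where a = t and b = 1 and d = "\<lambda>x. - w x" and d' = "\<lambda>x. - w' x"])
    fix x assume x: "x \<in> {t..1}"
    have "(w has_real_derivative w' x) (at x within {t..1})"
      by (rule DERIV_subset[OF D]) (use x t in auto)
    then show "((\<lambda>x. - w x) has_real_derivative - w' x) (at x within {t..1})"
      by (rule DERIV_minus)
    show "- w' x < 0" if "- w x = 0"
      using inc[of x] x t that by simp
  qed (use t \<open>w t > 0\<close> in auto)
  then show ?thesis
    by simp
qed

text \<open>The difference \<open>w\<close> satisfies \<epsilon> w' = f(v) - f(u) + s with s = l - k
  - r and vanishes at both ends. This first pins down \<open>l - k\<close>, hence bounds
  \<open>s\<close>, and a comparison argument then bounds \<open>w\<close>. Hypothesis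
  \<open>small\<close> keeps the barrier at most 1, so that \<open>lip\<close> is needed only at
  distance at most 1 from \<open>u\<close>.\<close>

lemma flux_perturbation_bound:
  fixes f :: "real \<Rightarrow> real"
  assumes \<epsilon>: "\<epsilon> > 0" and L: "L \<ge> 0"
    and v: "\<And>x. x \<in> {0..1} \<Longrightarrow> (v has_real_derivative g x) (at x within {0..1})"
    and u: "\<And>x. x \<in> {0..1} \<Longrightarrow> (u has_real_derivative p x) (at x within {0..1})"
    and bdry: "v 0 = u 0" "v 1 = u 1"
    and fv: "\<And>x. x \<in> {0..1} \<Longrightarrow> f (v x) - \<epsilon> * g x = k + r x"
    and fu: "\<And>x. x \<in> {0..1} \<Longrightarrow> f (u x) - \<epsilon> * p x = l"
    and r: "\<And>x. x \<in> {0..1} \<Longrightarrow> \<bar>r x\<bar> < \<eta>"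
    and lip: "\<And>x z. x \<in> {0..1} \<Longrightarrow> \<bar>z - u x\<bar> \<le> 1 \<Longrightarrow> \<bar>f z - f (u x)\<bar> \<le> L * \<bar>z - u x\<bar>"
    and small: "2 * \<eta> / \<epsilon> * exp (L / \<epsilon> + 1) \<le> 1"
    and x: "x \<in> {0..1}"
  shows "\<bar>v x - u x\<bar> \<le> 2 * \<eta> / \<epsilon> * exp (L / \<epsilon> + 1)"
    and "\<bar>g x - p x\<bar> \<le> (L * (2 * \<eta> / \<epsilon> * exp (L / \<epsilon> + 1)) + 2 * \<eta>) / \<epsilon>"
proof -
  define w where "w x = v x - u x" for x
  define s where "s x = l - k - r x" for x
  define w' where "w' x = g x - p x" for x
  have D: "(w has_real_derivative w' x) (at x within {0..1})" if "x \<in> {0..1}" for x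
    unfolding w_def w'_def using v[OF that] u[OF that] by (rule DERIV_diff)
  have w': "\<epsilon> * w' x = f (v x) - f (u x) + s x" if "x \<in> {0..1}" for x
    using fv[OF that] fu[OF that] by (simp add: w'_def s_def algebra_simps)
  have \<eta>: "\<eta> > 0"
    using r[of 0] by auto
  \<comment> \<open>Otherwise \<open>s\<close> is positive throughout, so \<open>w\<close> increases
    at each of its zeros and cannot return to 0 at the right end. The lower bound is the mirror
    image, with \<open>- w\<close>.\<close>
  have "l - k < \<eta>"
  proof (rule ccontr)
    assume "\<not> l - k < \<eta>"
    then have "s x > 0" if "x \<in> {0..1}" for x
      using r[OF that] by (auto simp: s_def)
    then have "\<epsilon> * w' x > 0" if "x \<in> {0..1}" "w x = 0" for x
      using w'[OF that(1)] that by (auto simp: w_def)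
    then have "w' x > 0" if "x \<in> {0..1}" "w x = 0" for x
      using that \<epsilon> zero_less_mult_pos by blast
    then have "w 1 > 0"
      using D bdry by (intro positive_if_increasing_at_zeros[of w w']) (auto simp: w_def)
    then show False
      using bdry by (simp add: w_def)
  qed
  moreover have "l - k > - \<eta>"
  proof (rule ccontr)
    assume "\<not> l - k > - \<eta>"
    then have "s x < 0" if "x \<in> {0..1}" for x
      using r[OF that] by (auto simp: s_def)
    then have "\<epsilon> * (- w' x) > 0" if "x \<in> {0..1}" "w x = 0" for x
      using w'[OF that(1)] that by (auto simp: w_def)
    then have "- w' x > 0" if "x \<in> {0..1}" "w x = 0" for x
      using that \<epsilon> zero_less_mult_pos by blast
    moreover have "((\<lambda>x. - w x) has_real_derivative - w' x) (at x within {0..1})" if "x \<in> {0..1}" for x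
      using D[OF that] by (rule DERIV_minus)
    ultimately have "- w 1 > 0"
      using bdry by (intro positive_if_increasing_at_zeros[of "\<lambda>x. - w x" "\<lambda>x. - w' x"]) (auto simp: w_def)
    then show False
      using bdry by (simp add: w_def)
  qed
  ultimately have s: "\<bar>s x\<bar> < 2 * \<eta>" if "x \<in> {0..1}" for x
    using r[OF that] by (auto simp: s_def)
  \<comment> \<open>The barrier satisfies \<epsilon> B' = (L + \<epsilon>) B. The summand 1 in
    \<open>K\<close> yields the extra \<epsilon> B, which dominates the source bound 2 \<eta>
    because \<open>B\<close> is at least 2 \<eta> / \<epsilon>.\<close>
  define K where "K = L / \<epsilon> + 1"
  define B where "B x = 2 * \<eta> / \<epsilon> * exp (K * x)" for x
  have K: "K \<ge> 1" "\<epsilon> * K = L + \<epsilon>"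
    using \<epsilon> L by (auto simp: K_def field_simps)
  have B: "B x \<ge> 2 * \<eta> / \<epsilon>" "B x \<le> 2 * \<eta> / \<epsilon> * exp K" "B x \<le> 1" if "x \<in> {0..1}" for x
  proof -
    have "K * x \<le> K" "0 \<le> K * x"
      using that K mult_left_le[of x K] by auto
    then show "B x \<ge> 2 * \<eta> / \<epsilon>" and *: "B x \<le> 2 * \<eta> / \<epsilon> * exp K"
      using \<epsilon> \<eta> mult_left_mono[of 1 "exp (K * x)" "2 * \<eta> / \<epsilon>"] by (auto simp: B_def intro!: divide_right_mono mult_left_mono)
    show "B x \<le> 1"
      using * small by (simp add: K_def)
  qed
  have DB: "(B has_real_derivative K * B x) (at x within {0..1})" for x
    unfolding B_def using \<epsilon> by (auto intro!: derivative_eq_intros)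
  have lipw: "\<bar>f (v x) - f (u x)\<bar> \<le> L * \<bar>w x\<bar>" if "x \<in> {0..1}" "\<bar>w x\<bar> \<le> 1" for x
    using lip that by (simp add: w_def)
  \<comment> \<open>At a first contact of \<open>\<bar>w\<bar>\<close> with the barrier \<open>B\<close> the slope of \<open>B\<close> wins.\<close>
  have slope: "\<bar>w' x\<bar> < K * B x" if x: "x \<in> {0..1}" and wB: "\<bar>w x\<bar> = B x" for x
  proof -
    have "\<epsilon> * \<bar>w' x\<bar> = \<bar>f (v x) - f (u x) + s x\<bar>"
      using \<epsilon> by (simp add: abs_mult flip: w'[OF x])
    also have "\<dots> < L * B x + 2 * \<eta>"
      using lipw[OF x, unfolded wB, OF B(3)[OF x]] s[OF x] by linarith
    also have "\<dots> \<le> L * B x + \<epsilon> * B x"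
      using B(1)[OF x] \<epsilon> by (simp add: field_simps)
    also have "\<dots> = \<epsilon> * (K * B x)"
      using K(2) by (simp add: algebra_simps flip: mult.assoc)
    finally show ?thesis
      using \<epsilon> by simp
  qed
  have B0: "B 0 > 0" "w 0 = 0" and Bpos: "B x > 0" for x
    using \<epsilon> \<eta> bdry by (auto simp: B_def w_def)
  have "w x - B x < 0"
  proof (rule negative_if_decreasing_at_zeros[where d' = "\<lambda>x. w' x - K * B x", OF _ _ _ x])
    show "((\<lambda>x. w x - B x) has_real_derivative w' x - K * B x) (at x within {0..1})" if "x \<in> {0..1}" for x
      using D[OF that] DB by (rule DERIV_diff)
    show "w' x - K * B x < 0" if "x \<in> {0..1}" "w x - B x = 0" for x
      using slope[OF that(1)] that(2) Bpos[of x] by auto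
  qed (use B0 in auto)
  moreover have "- w x - B x < 0"
  proof (rule negative_if_decreasing_at_zeros[where d' = "\<lambda>x. - w' x - K * B x", OF _ _ _ x])
    show "((\<lambda>x. - w x - B x) has_real_derivative - w' x - K * B x) (at x within {0..1})" if "x \<in> {0..1}" for x
      using DERIV_minus[OF D[OF that]] DB by (rule DERIV_diff)
    show "- w' x - K * B x < 0" if "x \<in> {0..1}" "- w x - B x = 0" for x
      using slope[OF that(1)] that(2) Bpos[of x] by auto
  qed (use B0 in auto)
  ultimately have wB: "\<bar>w x\<bar> \<le> B x"
    by linarith
  with B(2)[OF x] show "\<bar>v x - u x\<bar> \<le> 2 * \<eta> / \<epsilon> * exp (L / \<epsilon> + 1)"
    by (simp add: w_def K_def)
  have "\<epsilon> * \<bar>w' x\<bar> = \<bar>f (v x) - f (u x) + s x\<bar>"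
    using \<epsilon> by (simp add: abs_mult flip: w'[OF x])
  also have "\<dots> \<le> L * \<bar>w x\<bar> + 2 * \<eta>"
    using lipw[OF x order_trans[OF wB B(3)[OF x]]] s[OF x] by linarith
  also have "\<dots> \<le> L * (2 * \<eta> / \<epsilon> * exp K) + 2 * \<eta>"
    using wB B(2)[OF x] L by (intro add_right_mono mult_left_mono) auto
  finally show "\<bar>g x - p x\<bar> \<le> (L * (2 * \<eta> / \<epsilon> * exp (L / \<epsilon> + 1)) + 2 * \<eta>) / \<epsilon>"
    using \<epsilon> by (simp add: w'_def K_def pos_le_divide_eq mult.commute)
qed

lemma Lipschitz_if_C1:
  fixes p :: "real \<Rightarrow> real"
  assumes D: "\<And>x. (p has_real_derivative p' x) (at x)" and c: "continuous_on {a..b} p'"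
  obtains L where "L \<ge> 0" "\<And>x. x \<in> {a..b} \<Longrightarrow> \<bar>p' x\<bar> \<le> L"
    "\<And>x y. x \<in> {a..b} \<Longrightarrow> y \<in> {a..b} \<Longrightarrow> \<bar>p x - p y\<bar> \<le> L * \<bar>x - y\<bar>"
proof -
  obtain L where L: "L \<ge> 0" "\<And>x. x \<in> {a..b} \<Longrightarrow> \<bar>p' x\<bar> \<le> L"
    using continuous_on_Icc_bounded[OF c] by blast
  have "norm (p x - p y) \<le> L * norm (x - y)" if "x \<in> {a..b}" "y \<in> {a..b}" for x y
    by (rule field_differentiable_bound[where S = "{a..b}" and f' = p'])
       (use that L D in \<open>auto intro: has_field_derivative_at_within\<close>)
  then show ?thesis
    using that[of L] L by simp
qed

subsection \<open>Existence of a stationary profile\<close>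

text \<open>The majorant of \<open>q\<close> is affine on either side of \<open>m\<close>, so its
  reciprocal integrates to logarithms. The inequality (1 + x)(1 + y) \<ge> 1 + x + y, for
  nonnegative x and y, merges them into a bound that does not depend on the position of
  \<open>m\<close>.\<close>

lemma ln_integral_lower_bound:
  fixes q :: "real \<Rightarrow> real"
  assumes D: "D > 0" and L: "L > 0" and "a \<le> m" "m \<le> b" and c: "continuous_on {a..b} q"
    and q: "\<And>s. s \<in> {a..b} \<Longrightarrow> 0 < q s \<and> q s \<le> D + L * \<bar>s - m\<bar>"
  shows "ln (1 + L * (b - a) / D) / L \<le> integral {a..b} (\<lambda>s. inverse (q s))"
proof -
  have i: "(\<lambda>s. inverse (q s)) integrable_on {a..b}"
    using c q by (intro integrable_continuous_interval continuous_intros) force+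
  have left: "((\<lambda>s. inverse (D + L * (m - s))) has_integral
      (- ln (D + L * (m - m)) / L - (- ln (D + L * (m - a)) / L))) {a..m}"
  proof (rule fundamental_theorem_of_calculus)
    fix s assume "s \<in> {a..m}"
    then have "D + L * (m - s) > 0"
      using D L by (auto intro!: add_pos_nonneg)
    then have "((\<lambda>s. - ln (D + L * (m - s)) / L) has_real_derivative inverse (D + L * (m - s))) (at s within {a..m})"
      using L by (auto intro!: derivative_eq_intros simp: divide_inverse)
    then show "((\<lambda>s. - ln (D + L * (m - s)) / L) has_vector_derivative inverse (D + L * (m - s))) (at s within {a..m})"
      by (simp add: has_real_derivative_iff_has_vector_derivative)
  qed (use assms in auto)
  have right: "((\<lambda>s. inverse (D + L * (s - m))) has_integral
      (ln (D + L * (b - m)) / L - ln (D + L * (m - m)) / L)) {m..b}"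
  proof (rule fundamental_theorem_of_calculus)
    fix s assume "s \<in> {m..b}"
    then have "D + L * (s - m) > 0"
      using D L by (auto intro!: add_pos_nonneg)
    then have "((\<lambda>s. ln (D + L * (s - m)) / L) has_real_derivative inverse (D + L * (s - m))) (at s within {m..b})"
      using L by (auto intro!: derivative_eq_intros simp: divide_inverse)
    then show "((\<lambda>s. ln (D + L * (s - m)) / L) has_vector_derivative inverse (D + L * (s - m))) (at s within {m..b})"
      by (simp add: has_real_derivative_iff_has_vector_derivative)
  qed (use assms in auto)
  have "1 + L * (b - a) / D \<le> (1 + L * (m - a) / D) * (1 + L * (b - m) / D)"
  proof -
    have "(1 + L * (m - a) / D) * (1 + L * (b - m) / D)
        = 1 + L * (b - a) / D + (L * (m - a) / D) * (L * (b - m) / D)"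
      using D by (simp add: field_simps)
    moreover have "0 \<le> (L * (m - a) / D) * (L * (b - m) / D)"
      using D L assms by simp
    ultimately show ?thesis
      by linarith
  qed
  moreover have pos: "1 + L * (m - a) / D > 0" "1 + L * (b - m) / D > 0" "1 + L * (b - a) / D > 0"
    using D L assms by (auto intro!: add_pos_nonneg)
  ultimately have "ln (1 + L * (b - a) / D) \<le> ln (1 + L * (m - a) / D) + ln (1 + L * (b - m) / D)"
    by (simp add: ln_mult_pos[symmetric])
  also have "\<dots> = (ln (D + L * (m - a)) - ln D) + (ln (D + L * (b - m)) - ln D)"
  proof -
    have "1 + L * t / D = (D + L * t) / D" for t
      using D by (simp add: field_simps)
    moreover have "ln ((D + L * t) / D) = ln (D + L * t) - ln D" if "t \<ge> 0" for t
    proof -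
      have "D + L * t > 0"
        using D L that by (intro add_pos_nonneg) auto
      then show ?thesis
        using D by (simp add: ln_div)
    qed
    ultimately show ?thesis
      using assms by simp
  qed
  finally have "ln (1 + L * (b - a) / D) / L
      \<le> ((ln (D + L * (m - a)) - ln D) + (ln (D + L * (b - m)) - ln D)) / L"
    using L by (simp add: divide_right_mono)
  also have "\<dots> = integral {a..m} (\<lambda>s. inverse (D + L * (m - s))) + integral {m..b} (\<lambda>s. inverse (D + L * (s - m)))"
    unfolding integral_unique[OF left] integral_unique[OF right]
    by (simp add: diff_divide_distrib add_divide_distrib)
  also have "\<dots> \<le> integral {a..m} (\<lambda>s. inverse (q s)) + integral {m..b} (\<lambda>s. inverse (q s))"
  proof (rule add_mono)
    show "integral {a..m} (\<lambda>s. inverse (D + L * (m - s))) \<le> integral {a..m} (\<lambda>s. inverse (q s))"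
    proof (rule integral_le)
      show "(\<lambda>s. inverse (q s)) integrable_on {a..m}"
        using integrable_on_subinterval[OF i] assms by auto
      show "inverse (D + L * (m - s)) \<le> inverse (q s)" if "s \<in> {a..m}" for s
        using q[of s] that assms(3,4) by (intro le_imp_inverse_le) auto
    qed (use left in blast)
    show "integral {m..b} (\<lambda>s. inverse (D + L * (s - m))) \<le> integral {m..b} (\<lambda>s. inverse (q s))"
    proof (rule integral_le)
      show "(\<lambda>s. inverse (q s)) integrable_on {m..b}"
        using integrable_on_subinterval[OF i] assms by auto
      show "inverse (D + L * (s - m)) \<le> inverse (q s)" if "s \<in> {m..b}" for s
        using q[of s] that assms(3,4) by (intro le_imp_inverse_le) auto
    qed (use right in blast)
  qed
  also have "\<dots> = integral {a..b} (\<lambda>s. inverse (q s))"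
    using assms i by (intro Henstock_Kurzweil_Integration.integral_combine) auto
  finally show ?thesis .
qed

text \<open>The travel time \<open>\<tau>\<close> depends continuously on \<open>k\<close> above the
  maximum \<open>f m\<close>. It is at least \<open>T\<close> at \<open>f m + D\<close> and at most
  \<open>T\<close> at \<open>f m + D'\<close>, so the intermediate value theorem applies.\<close>

lemma exists_flux_constant:
  fixes f :: "real \<Rightarrow> real"
  assumes "a < b" "T > 0" "L > 0" and c: "continuous_on {a..b} f"
    and lip: "\<And>x y. x \<in> {a..b} \<Longrightarrow> y \<in> {a..b} \<Longrightarrow> \<bar>f x - f y\<bar> \<le> L * \<bar>x - y\<bar>"
  obtains k where "\<And>s. s \<in> {a..b} \<Longrightarrow> f s < k" "integral {a..b} (\<lambda>s. inverse (k - f s)) = T"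
proof -
  obtain m where m: "m \<in> {a..b}" "\<And>s. s \<in> {a..b} \<Longrightarrow> f s \<le> f m"
    using continuous_attains_sup[of "{a..b}" f] c assms(1) by auto
  define \<tau> where "\<tau> k = integral {a..b} (\<lambda>s. inverse (k - f s))" for k
  \<comment> \<open>\<open>D\<close> makes the quotient in the logarithmic bound equal to exp(L T),
    which forces a time of at least \<open>T\<close>. A gap of (b - a) / T bounds the integrand by T
    / (b - a), hence the time by \<open>T\<close>; the maximum in \<open>D'\<close> keeps the two
    gaps in order.\<close>
  define D where "D = L * (b - a) / exp (L * T)"
  define D' where "D' = max D ((b - a) / T)"
  have D: "D > 0" "D \<le> D'"
    using assms by (auto simp: D_def D'_def)
  have "ln (1 + L * (b - a) / D) / L \<le> \<tau> (f m + D)"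
    unfolding \<tau>_def
  proof (rule ln_integral_lower_bound)
    show "0 < f m + D - f s \<and> f m + D - f s \<le> D + L * \<bar>s - m\<bar>" if "s \<in> {a..b}" for s
      using m(2)[OF that] lip[OF m(1) that] D by (simp add: abs_minus_commute)
  qed (use assms m D in \<open>auto intro!: continuous_intros\<close>)
  moreover have "L * (b - a) / D = exp (L * T)"
    using assms by (simp add: D_def)
  moreover have "L * T \<le> ln (1 + exp (L * T))"
    by (subst ln_ge_iff) (auto intro: add_pos_pos)
  ultimately have lo: "T \<le> \<tau> (f m + D)"
    using assms(3) by (smt (verit, ccfv_SIG) divide_right_mono nonzero_mult_div_cancel_left)
  have hi: "\<tau> (f m + D') \<le> T"
  proof -
    have "(b - a) / T \<le> f m + D' - f s" if "s \<in> {a..b}" for s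
      using m(2)[OF that] by (simp add: D'_def)
    moreover have "(b - a) / T > 0"
      using assms by simp
    ultimately have le: "inverse (f m + D' - f s) \<le> T / (b - a)" if "s \<in> {a..b}" for s
      using le_imp_inverse_le[of "(b - a) / T"] that by fastforce
    have "\<tau> (f m + D') \<le> integral {a..b} (\<lambda>s. T / (b - a))"
      unfolding \<tau>_def
    proof (rule integral_le)
      show "(\<lambda>s. inverse (f m + D' - f s)) integrable_on {a..b}"
        using D m by (intro integrable_continuous_interval continuous_intros c) force
    qed (use le in auto)
    also have "\<dots> = T"
      using assms by simp
    finally show ?thesis .
  qed
  have "continuous_on {f m + D..f m + D'} \<tau>"
  proof -
    have "continuous_on ({f m + D..f m + D'} \<times> cbox a b) (\<lambda>(k, s). inverse (k - f s))"
      unfolding split_beta using m D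
      by (intro continuous_intros continuous_on_compose2[OF c]) force+
    then show ?thesis
      using integral_continuous_on_param[of "{f m + D..f m + D'}" a b "\<lambda>k s. inverse (k - f s)"]
      by (simp add: \<tau>_def[abs_def])
  qed
  then obtain k where k: "f m + D \<le> k" "\<tau> k = T"
    using IVT2'[of \<tau> "f m + D'" T "f m + D"] lo hi D by auto
  have "f s < k" if "s \<in> {a..b}" for s
    using m(2)[OF that] k D by linarith
  then show ?thesis
    using that[of k] k(2) by (simp add: \<tau>_def)
qed

text \<open>Separation of variables: \<open>X s\<close> is the position at which the profile takes
  the value \<open>s\<close>. It maps [a,b] bijectively and decreasingly onto [0,1], and its inverse
  solves the differential equation in the interior.\<close>

lemma exists_profile:
  fixes f :: "real \<Rightarrow> real"
  assumes "a < b" "\<epsilon> > 0" and c: "continuous_on {a..b} f"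
    and k: "\<And>s. s \<in> {a..b} \<Longrightarrow> f s < k" "integral {a..b} (\<lambda>s. inverse (k - f s)) = 1 / \<epsilon>"
  obtains v where "continuous_on {0..1} v" "v 0 = b" "v 1 = a" "\<And>x. x \<in> {0..1} \<Longrightarrow> v x \<in> {a..b}"
    "\<And>x. x \<in> {0<..<1} \<Longrightarrow> (v has_real_derivative (f (v x) - k) / \<epsilon>) (at x)"
proof -
  define q where "q s = \<epsilon> * inverse (k - f s)" for s
  have q: "q s > 0" "q s = inverse ((k - f s) / \<epsilon>)" if "s \<in> {a..b}" for s
    using k(1)[OF that] assms(2) by (auto simp: q_def divide_inverse)
  have cq: "continuous_on {a..b} q"
    unfolding q_def using k(1) by (intro continuous_intros c) force
  define X where "X s = integral {s..b} q" for s
  have Xa: "X a = 1" and Xb: "X b = 0"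
    using k(2) assms(2) by (auto simp: X_def q_def[abs_def])
  have DX: "(X has_real_derivative - q s) (at s within {a..b})" if "s \<in> {a..b}" for s
    unfolding X_def using cq that by (rule integral_has_real_derivative')
  have cX: "continuous_on {a..b} X"
    by (rule DERIV_continuous_on[OF DX])
  have DXi: "(X has_real_derivative - q s) (at s)" if "s \<in> {a<..<b}" for s
    using DX[of s] that at_within_Icc_at[of a s b] by auto
  have dec: "X t < X s" if "s \<in> {a..b}" "t \<in> {a..b}" "s < t" for s t
  proof (rule DERIV_neg_imp_decreasing_open[OF \<open>s < t\<close>])
    show "\<exists>y. (X has_real_derivative y) (at x) \<and> y < 0" if "s < x" "x < t" for x
      using DXi[of x] q[of x] that \<open>s \<in> {a..b}\<close> \<open>t \<in> {a..b}\<close> by (intro exI[of _ "- q x"]) auto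
    show "continuous_on {s..t} X"
      using cX by (rule continuous_on_subset) (use that in auto)
  qed
  then have inj: "inj_on X {a..b}"
    by (intro linorder_inj_onI') (metis less_irrefl)
  have ran: "X ` {a..b} = {0..1}"
  proof
    show "X ` {a..b} \<subseteq> {0..1}"
    proof
      fix y assume "y \<in> X ` {a..b}"
      then obtain s where s: "s \<in> {a..b}" "y = X s" by blast
      have "X s \<le> X a" "X b \<le> X s"
        using dec[of a s] dec[of s b] s assms(1) by (cases "s = a"; cases "s = b"; auto)+
      then show "y \<in> {0..1}"
        using s Xa Xb by simp
    qed
    show "{0..1} \<subseteq> X ` {a..b}"
    proof
      fix y :: real assume "y \<in> {0..1}"
      then obtain s where "a \<le> s" "s \<le> b" "X s = y"
        using IVT2'[of X b y a] Xa Xb assms(1) cX by auto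
      then show "y \<in> X ` {a..b}" by auto
    qed
  qed
  define v where "v = the_inv_into {a..b} X"
  have Xv: "X (v x) = x" and vin: "v x \<in> {a..b}" if "x \<in> {0..1}" for x
    using that f_the_inv_into_f[OF inj] the_inv_into_into[OF inj _ order_refl] by (auto simp: v_def ran)
  have vX: "v (X s) = s" if "s \<in> {a..b}" for s
    using the_inv_into_f_f[OF inj that] by (simp add: v_def)
  have cv: "continuous_on {0..1} v"
    using continuous_on_inv_into[OF cX _ ] continuous_on_inv[OF cX compact_Icc, of v] vX ran by auto
  have v01: "v 0 = b" "v 1 = a"
    using vX[of b] vX[of a] Xa Xb assms(1) by auto
  moreover have "(v has_real_derivative (f (v x) - k) / \<epsilon>) (at x)" if x: "x \<in> {0<..<1}" for x
  proof -
    have "v x \<in> {a..b}" "v x \<noteq> a" "v x \<noteq> b"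
      using vin[of x] Xv[of x] Xa Xb x by auto
    then have vx: "v x \<in> {a<..<b}"
      by auto
    have cont: "isCont v x"
      using cv x by (intro continuous_on_interior[of "{0..1}"]) auto
    have "(v has_real_derivative inverse (- q (v x))) (at x)"
    proof (rule DERIV_inverse_function[of X _ v x 0 1])
      show "DERIV X (v x) :> - q (v x)"
        using DXi[OF vx] .
      show "- q (v x) \<noteq> 0"
        using q(1)[of "v x"] vx by simp
    qed (use x Xv cont in auto)
    also have "inverse (- q (v x)) = (f (v x) - k) / \<epsilon>"
      using q(2)[of "v x"] vx by (simp add: diff_divide_distrib)
    finally show ?thesis .
  qed
  ultimately show ?thesis
    using that[of v] cv vin by blast
qed

lemma exists_stationary_triple:
  fixes f :: "real \<Rightarrow> real"
  assumes "ur < ul" "\<epsilon> > 0" and f: "C2_fun f"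
  obtains v g h k where "H2_triple v g h" "v 0 = ul" "v 1 = ur"
    "\<And>x. x \<in> {0..1} \<Longrightarrow> f (v x) - \<epsilon> * g x = k" "\<And>x. x \<in> {0..1} \<Longrightarrow> deriv f (v x) * g x - \<epsilon> * h x = 0"
proof -
  note fD = C2_funD[OF f]
  obtain L where L: "L \<ge> 0" "\<And>x y. x \<in> {ur..ul} \<Longrightarrow> y \<in> {ur..ul} \<Longrightarrow> \<bar>f x - f y\<bar> \<le> L * \<bar>x - y\<bar>"
    using Lipschitz_if_C1[OF fD(1,2), of ur ul] by metis
  \<comment> \<open>Raising the constant by 1 makes it strictly positive, as the logarithmic
    estimate divides by it.\<close>
  have lip: "\<bar>f x - f y\<bar> \<le> (L + 1) * \<bar>x - y\<bar>" if "x \<in> {ur..ul}" "y \<in> {ur..ul}" for x y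
    using L(2)[OF that] by (simp add: distrib_right)
  have pos: "1 / \<epsilon> > 0" "L + 1 > 0"
    using assms(2) L(1) by simp_all
  obtain k where k: "\<And>s. s \<in> {ur..ul} \<Longrightarrow> f s < k"
    "integral {ur..ul} (\<lambda>s. inverse (k - f s)) = 1 / \<epsilon>"
    using exists_flux_constant[OF assms(1) pos fD(3) lip] by blast
  obtain v where cv: "continuous_on {0..1} v" and v: "v 0 = ul" "v 1 = ur"
    and D: "\<And>x. x \<in> {0<..<1} \<Longrightarrow> (v has_real_derivative (f (v x) - k) / \<epsilon>) (at x)"
    using exists_profile[OF assms(1,2) fD(3) k] by metis
  define g where "g x = (f (v x) - k) / \<epsilon>" for x
  \<comment> \<open>The second derivative is obtained by differentiating the first-order equation
    once more.\<close>
  define h where "h x = deriv f (v x) * g x / \<epsilon>" for x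
  have cf: "continuous_on {0..1} (\<lambda>x. f (v x))" "continuous_on {0..1} (\<lambda>x. deriv f (v x))"
    by (rule continuous_on_compose2[OF fD(3) cv subset_UNIV] continuous_on_compose2[OF fD(2) cv subset_UNIV])+
  have cg: "continuous_on {0..1} g"
    unfolding g_def using assms(2) by (intro continuous_intros cf) auto
  have ch: "continuous_on {0..1} h"
    unfolding h_def using assms(2) by (intro continuous_intros cf cg) auto
  have Dg: "(g has_real_derivative h x) (at x)" if "x \<in> {0<..<1}" for x
  proof -
    have "((\<lambda>x. f (v x)) has_real_derivative deriv f (v x) * ((f (v x) - k) / \<epsilon>)) (at x)"
      using DERIV_chain2[OF fD(1) D[OF that]] by simp
    from DERIV_cdivide[OF DERIV_diff[OF this DERIV_const[of k]], of \<epsilon>] show ?thesis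
      by (simp add: g_def[abs_def] h_def)
  qed
  \<comment> \<open>The derivatives are known only in the open interval; continuity up to the ends
    suffices for the fundamental theorem.\<close>
  have ftc: "integral {0..x} p' = p x - p 0"
    if "continuous_on {0..1} p" "\<And>x. x \<in> {0<..<1} \<Longrightarrow> (p has_real_derivative p' x) (at x)" "x \<in> {0..1}"
    for p p' :: "real \<Rightarrow> real" and x
  proof (rule integral_unique, rule fundamental_theorem_of_calculus_interior)
    show "continuous_on {0..x} p"
      using that(1) by (rule continuous_on_subset) (use that in auto)
  qed (use that in \<open>auto simp: has_real_derivative_iff_has_vector_derivative[symmetric]\<close>)
  have "H2_triple v g h"
    unfolding H2_triple_def
  proof (intro conjI ballI)
    show "h \<in> L2"
      using ch by (rule continuous_on_L2)
    show "g x = g 0 + integral {0..x} h" if "x \<in> {0..1}" for x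
      using ftc[OF cg Dg that] by simp
    show "v x = v 0 + integral {0..x} g" if "x \<in> {0..1}" for x
      using ftc[OF cv, of g, OF _ that] D by (simp add: g_def)
  qed
  moreover have "f (v x) - \<epsilon> * g x = k" "deriv f (v x) * g x - \<epsilon> * h x = 0" for x
    using assms(2) by (auto simp: g_def h_def)
  ultimately show ?thesis
    using that v by blast
qed

subsection \<open>Coercivity of the residual\<close>

lemma LINT_unit_power2_le:
  assumes "p \<in> L2" "\<And>x. x \<in> {0..1} \<Longrightarrow> \<bar>p x\<bar> \<le> b"
  shows "(LINT x|unit_meas. (p x)\<^sup>2) \<le> b\<^sup>2"
proof -
  have "(LINT x|unit_meas. (p x)\<^sup>2) \<le> (LINT x|unit_meas. b\<^sup>2)"
  proof (rule integral_mono)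
    show "integrable unit_meas (\<lambda>x. (p x)\<^sup>2)"
      using assms(1) by (simp add: L2_def)
    show "integrable unit_meas (\<lambda>x. b\<^sup>2)"
      by (rule continuous_on_integrable_unit) simp
    fix x assume "x \<in> space unit_meas"
    then have "\<bar>p x\<bar> \<le> b"
      using assms(2)[of x] by simp
    then show "(p x)\<^sup>2 \<le> b\<^sup>2"
      by (simp add: abs_le_square_iff[symmetric])
  qed
  then show ?thesis
    by (simp only: LINT_unit_const)
qed

lemma H2_norm_triple:
  assumes t: "H2_triple v g h" and ae: "AE x in unit_meas. u x = v x"
  shows "H2_norm u = sqrt ((LINT x|unit_meas. (v x)\<^sup>2) + (LINT x|unit_meas. (g x)\<^sup>2)
      + (LINT x|unit_meas. (h x)\<^sup>2))"
  using LINT_unit_power2_cong_AE[OF ae H2_tripleD(4)[OF t]]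
    LINT_unit_power2_cong_AE[OF H2_triple_rep(3)[OF t ae] H2_tripleD(3)[OF t]]
    LINT_unit_power2_cong_AE[OF H2_triple_rep(4)[OF t ae] H2_tripleD(5)[OF t]]
  by (simp add: H2_norm_def)

lemma H2_norm_le_0_imp_AE_0:
  assumes "u \<in> H2" "H2_norm u \<le> 0"
  shows "AE x in unit_meas. u x = 0"
proof -
  have nn: "(LINT x|unit_meas. (p x)\<^sup>2) \<ge> 0" for p :: "real \<Rightarrow> real"
    by simp
  have "(LINT x|unit_meas. (u x)\<^sup>2) + (LINT x|unit_meas. (weak_deriv u x)\<^sup>2)
      + (LINT x|unit_meas. (weak_deriv (weak_deriv u) x)\<^sup>2) \<le> 0"
    using assms(2) by (simp add: H2_norm_def)
  then have "(LINT x|unit_meas. (u x)\<^sup>2) = 0"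
    using nn[of u] nn[of "weak_deriv u"] nn[of "weak_deriv (weak_deriv u)"] by linarith
  moreover have "integrable unit_meas (\<lambda>x. (u x)\<^sup>2)"
    using assms(1) by (simp add: H2_def L2_def)
  ultimately have "AE x in unit_meas. (u x)\<^sup>2 = 0"
    by (subst (asm) integral_nonneg_eq_0_iff_AE) auto
  then show ?thesis
    by eventually_elim simp
qed

lemma C2_fun_deriv_DERIV:
  assumes "C2_fun f"
  shows "\<And>x. (deriv f has_real_derivative deriv (deriv f) x) (at x)" "continuous_on S (deriv (deriv f))"
proof -
  have c1: "deriv f C1_differentiable_on UNIV"
    using assms by (simp add: C2_fun_def)
  then show D: "(deriv f has_real_derivative deriv (deriv f) x) (at x)" for x
    by (auto simp: C1_differentiable_on_eq DERIV_deriv_iff_real_differentiable)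
  have "vector_derivative (deriv f) (at x) = deriv (deriv f) x" for x
    by (rule vector_derivative_at) (use D in \<open>simp add: has_real_derivative_iff_has_vector_derivative\<close>)
  then show "continuous_on S (deriv (deriv f))"
    using c1 continuous_on_subset[of UNIV _ S] by (auto simp: C1_differentiable_on_eq)
qed

text \<open>The integrated equation controls \<open>V - v\<close> and \<open>G - g\<close>
  uniformly, and the equation itself then controls \<open>H - h\<close> in L2. The bound is in terms
  of a number \<open>\<eta>\<close> strictly above sqrt(2 J) because the comparison argument needs a
  strict bound on the perturbation; this also covers J = 0.\<close>

lemma H2_norm_le_residual:
  assumes \<epsilon>: "\<epsilon> > 0" and f: "C2_fun f" and t: "H2_triple v g h"
    and flux: "\<And>x. x \<in> {0..1} \<Longrightarrow> f (v x) - \<epsilon> * g x = k"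
    and res: "\<And>x. x \<in> {0..1} \<Longrightarrow> deriv f (v x) * g x - \<epsilon> * h x = 0"
  obtains C \<eta>0 where "C \<ge> 0" "\<eta>0 > 0"
    "\<And>U \<eta>. \<lbrakk>U \<in> H2_bdry (v 0) (v 1); sqrt (2 * J f \<epsilon> U) < \<eta>; \<eta> \<le> \<eta>0\<rbrakk>
      \<Longrightarrow> H2_norm (\<lambda>x. U x - v x) \<le> C * \<eta>"
proof -
  note T = H2_tripleD[OF t]
  obtain B where B: "B \<ge> 0" "\<And>x. x \<in> {0..1} \<Longrightarrow> \<bar>v x\<bar> \<le> B"
    using continuous_on_Icc_bounded[OF T(2)] by blast
  obtain M where M: "M \<ge> 0" "\<And>x. x \<in> {0..1} \<Longrightarrow> \<bar>g x\<bar> \<le> M"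
    using continuous_on_Icc_bounded[OF T(1)] by blast
  \<comment> \<open>An interval containing every point within distance 1 of the range of
    \<open>v\<close>; the Lipschitz constants of \<open>f\<close> and \<open>deriv f\<close> are
    taken on it.\<close>
  define N where "N = {-(B+1)..B+1}"
  have N: "z \<in> N" if "\<bar>z - v x\<bar> \<le> 1" "x \<in> {0..1}" for z x
    using B(2)[OF that(2)] that(1) unfolding N_def by auto
  have vN: "v x \<in> N" if "x \<in> {0..1}" for x
    using N[of "v x" x] that by simp
  obtain L where L: "L \<ge> 0" "\<And>x. x \<in> N \<Longrightarrow> \<bar>deriv f x\<bar> \<le> L"
    "\<And>x y. x \<in> N \<Longrightarrow> y \<in> N \<Longrightarrow> \<bar>f x - f y\<bar> \<le> L * \<bar>x - y\<bar>"
    by (rule Lipschitz_if_C1[OF C2_funD(1,2)[OF f], of "-(B+1)" "B+1", folded N_def]) (rule that)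
  obtain L' where L': "L' \<ge> 0"
    "\<And>x y. x \<in> N \<Longrightarrow> y \<in> N \<Longrightarrow> \<bar>deriv f x - deriv f y\<bar> \<le> L' * \<bar>x - y\<bar>"
    by (rule Lipschitz_if_C1[OF C2_fun_deriv_DERIV[OF f], of "-(B+1)" "B+1", folded N_def]) (rule that)
  \<comment> \<open>The distances of the values, of the first derivatives and of the terms
    \<open>deriv f (v x) * g x\<close> will be at most \<open>\<alpha> * \<eta>\<close>,
    \<open>\<beta> * \<eta>\<close> and \<open>\<gamma> * \<eta>\<close>. The threshold
    \<open>\<eta>0\<close> ensures \<open>\<alpha> * \<eta> \<le> 1\<close>, and \<open>C\<close>
    collects the three squared L2 contributions.\<close>
  define \<alpha> where "\<alpha> = 2 / \<epsilon> * exp (L / \<epsilon> + 1)"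
  define \<eta>0 where "\<eta>0 = 1 / \<alpha>"
  define \<beta> where "\<beta> = (L * \<alpha> + 2) / \<epsilon>"
  define \<gamma> where "\<gamma> = L' * \<alpha> * (M + \<beta> * \<eta>0) + L * \<beta>"
  define C where "C = sqrt (\<alpha>\<^sup>2 + \<beta>\<^sup>2 + (2 * \<gamma>\<^sup>2 + 2) / \<epsilon>\<^sup>2)"
  have pos: "\<alpha> > 0" "\<eta>0 > 0" "\<beta> > 0"
    using \<epsilon> L(1) by (auto simp: \<alpha>_def \<eta>0_def \<beta>_def intro!: divide_pos_pos add_nonneg_pos)
  have "H2_norm (\<lambda>x. U x - v x) \<le> C * \<eta>"
    if U: "U \<in> H2_bdry (v 0) (v 1)" and \<rho>: "sqrt (2 * J f \<epsilon> U) < \<eta>" and \<eta>: "\<eta> \<le> \<eta>0" for U \<eta>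
  proof -
    have "U \<in> H2"
      using U by (simp add: H2_bdry_def)
    then obtain V G H where t': "H2_triple V G H" and ae: "AE x in unit_meas. U x = V x"
      using H2_obtain_triple by blast
    note T' = H2_tripleD[OF t']
    have bdry: "V 0 = v 0" "V 1 = v 1"
      using U H2_triple_rep(2)[OF t' ae, of 0] H2_triple_rep(2)[OF t' ae, of 1]
      by (simp_all add: H2_bdry_def)
    define F where "F x = deriv f (V x) * G x - \<epsilon> * H x" for x
    note R = H2_triple_residual[OF t' ae f, where \<epsilon> = \<epsilon>, folded F_def]
    have F2: "sqrt (LINT x|unit_meas. (F x)\<^sup>2) < \<eta>"
      using \<rho> R(3) by simp
    then have \<eta>pos: "\<eta> > 0"
      by (rule le_less_trans[rotated]) simp
    have F2': "(LINT x|unit_meas. (F x)\<^sup>2) \<le> \<eta>\<^sup>2"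
      using F2 \<eta>pos by (simp add: sqrt_le_D less_imp_le)
    have \<alpha>\<eta>: "2 * \<eta> / \<epsilon> * exp (L / \<epsilon> + 1) = \<alpha> * \<eta>"
      by (simp add: \<alpha>_def)
    have \<alpha>\<eta>1: "\<alpha> * \<eta> \<le> 1"
      using \<eta> pos by (simp add: \<eta>0_def pos_le_divide_eq mult.commute)
    have est: "\<bar>V x - v x\<bar> \<le> \<alpha> * \<eta>" "\<bar>G x - g x\<bar> \<le> \<beta> * \<eta>" if x: "x \<in> {0..1}" for x
    proof -
      note flux_bound = flux_perturbation_bound[OF \<epsilon> L(1) T'(6) T(6) bdry R(4) flux _ _ _ x,
          where \<eta> = \<eta>, unfolded \<alpha>\<eta>]
      have r: "\<bar>integral {0..y} F\<bar> < \<eta>" if "y \<in> {0..1}" for y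
        using abs_integral_le_L2[OF R(1) that] F2 by simp
      have lip: "\<bar>f z - f (v y)\<bar> \<le> L * \<bar>z - v y\<bar>" if "y \<in> {0..1}" "\<bar>z - v y\<bar> \<le> 1" for y z
        using L(3)[OF N[OF that(2,1)] vN[OF that(1)]] .
      show "\<bar>V x - v x\<bar> \<le> \<alpha> * \<eta>"
        by (rule flux_bound(1)) (use r lip \<alpha>\<eta>1 in auto)
      have "\<bar>G x - g x\<bar> \<le> (L * (\<alpha> * \<eta>) + 2 * \<eta>) / \<epsilon>"
        by (rule flux_bound(2)) (use r lip \<alpha>\<eta>1 in auto)
      also have "\<dots> = \<beta> * \<eta>"
        by (simp add: \<beta>_def algebra_simps)
      finally show "\<bar>G x - g x\<bar> \<le> \<beta> * \<eta>" .
    qed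
    have estH: "(H x - h x)\<^sup>2 \<le> (2 * (\<gamma> * \<eta>)\<^sup>2 + 2 * (F x)\<^sup>2) / \<epsilon>\<^sup>2" if x: "x \<in> {0..1}" for x
    proof -
      define A where "A = deriv f (V x) * G x - deriv f (v x) * g x"
      have VN: "V x \<in> N"
        using N[of "V x" x] est(1)[OF x] \<alpha>\<eta>1 x by simp
      have "\<bar>G x\<bar> \<le> M + \<beta> * \<eta>"
        using est(2)[OF x] M(2)[OF x] by linarith
      also have "\<dots> \<le> M + \<beta> * \<eta>0"
        using \<eta> pos by simp
      finally have G: "\<bar>G x\<bar> \<le> M + \<beta> * \<eta>0" .
      \<comment> \<open>One factor changes at a time: the first term uses the Lipschitz bound of
        \<open>deriv f\<close> and a uniform bound on \<open>G\<close>, the second the bound of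
        \<open>deriv f\<close> on \<open>N\<close>.\<close>
      have "A = (deriv f (V x) - deriv f (v x)) * G x + deriv f (v x) * (G x - g x)"
        by (simp add: A_def algebra_simps)
      then have "\<bar>A\<bar> \<le> \<bar>deriv f (V x) - deriv f (v x)\<bar> * \<bar>G x\<bar> + \<bar>deriv f (v x)\<bar> * \<bar>G x - g x\<bar>"
        by (simp add: abs_mult[symmetric] abs_triangle_ineq)
      also have "\<dots> \<le> (L' * (\<alpha> * \<eta>)) * (M + \<beta> * \<eta>0) + L * (\<beta> * \<eta>)"
      proof (intro add_mono mult_mono)
        have "\<bar>deriv f (V x) - deriv f (v x)\<bar> \<le> L' * \<bar>V x - v x\<bar>"
          using L'(2)[OF VN vN[OF x]] .
        also have "\<dots> \<le> L' * (\<alpha> * \<eta>)"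
          using est(1)[OF x] L'(1) by (rule mult_left_mono)
        finally show "\<bar>deriv f (V x) - deriv f (v x)\<bar> \<le> L' * (\<alpha> * \<eta>)" .
      qed (use G L L' vN x est pos \<eta>pos in auto)
      also have "\<dots> = \<gamma> * \<eta>"
        by (simp add: \<gamma>_def algebra_simps)
      finally have A: "A\<^sup>2 \<le> (\<gamma> * \<eta>)\<^sup>2"
        by (simp add: abs_le_square_iff[symmetric])
      have "\<epsilon> * (H x - h x) = A - F x"
        using res[OF x] by (simp add: A_def F_def algebra_simps)
      then have "\<epsilon>\<^sup>2 * (H x - h x)\<^sup>2 = (A - F x)\<^sup>2"
        by (simp add: power_mult_distrib[symmetric])
      also have "\<dots> \<le> 2 * A\<^sup>2 + 2 * (F x)\<^sup>2"
        using zero_le_power2[of "A + F x"] by (simp add: power2_eq_square algebra_simps)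
      also have "\<dots> \<le> 2 * (\<gamma> * \<eta>)\<^sup>2 + 2 * (F x)\<^sup>2"
        using A by simp
      finally show ?thesis
        using \<epsilon> by (simp add: pos_le_divide_eq mult.commute)
    qed
    note d = H2_triple_diff[OF t' t]
    have "(LINT x|unit_meas. (H x - h x)\<^sup>2) \<le> (LINT x|unit_meas. (2 * (\<gamma> * \<eta>)\<^sup>2 + 2 * (F x)\<^sup>2) / \<epsilon>\<^sup>2)"
    proof (rule integral_mono)
      show "integrable unit_meas (\<lambda>x. (H x - h x)\<^sup>2)"
        using H2_tripleD(5)[OF d] by (simp add: L2_def)
      have "integrable unit_meas (\<lambda>x. 2 * (\<gamma> * \<eta>)\<^sup>2)"
        by (rule continuous_on_integrable_unit) simp
      then show "integrable unit_meas (\<lambda>x. (2 * (\<gamma> * \<eta>)\<^sup>2 + 2 * (F x)\<^sup>2) / \<epsilon>\<^sup>2)"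
        using R(1) by (intro integrable_divide Bochner_Integration.integrable_add) (auto simp: L2_def)
    qed (use estH in auto)
    also have "\<dots> = (2 * (\<gamma> * \<eta>)\<^sup>2 + 2 * (LINT x|unit_meas. (F x)\<^sup>2)) / \<epsilon>\<^sup>2"
    proof -
      have "integrable unit_meas (\<lambda>x. 2 * (\<gamma> * \<eta>)\<^sup>2)"
        by (rule continuous_on_integrable_unit) simp
      moreover have "integrable unit_meas (\<lambda>x. 2 * (F x)\<^sup>2)"
        using R(1) by (simp add: L2_def)
      ultimately have "(LINT x|unit_meas. 2 * (\<gamma> * \<eta>)\<^sup>2 + 2 * (F x)\<^sup>2)
          = 2 * (\<gamma> * \<eta>)\<^sup>2 + 2 * (LINT x|unit_meas. (F x)\<^sup>2)"
        by (subst Bochner_Integration.integral_add) (simp_all only: LINT_unit_const integral_mult_right_zero)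
      then show ?thesis
        by simp
    qed
    also have "\<dots> \<le> (2 * (\<gamma> * \<eta>)\<^sup>2 + 2 * \<eta>\<^sup>2) / \<epsilon>\<^sup>2"
      using F2' by (intro divide_right_mono) auto
    finally have "(LINT x|unit_meas. (V x - v x)\<^sup>2) + (LINT x|unit_meas. (G x - g x)\<^sup>2)
        + (LINT x|unit_meas. (H x - h x)\<^sup>2)
        \<le> (\<alpha> * \<eta>)\<^sup>2 + (\<beta> * \<eta>)\<^sup>2 + (2 * (\<gamma> * \<eta>)\<^sup>2 + 2 * \<eta>\<^sup>2) / \<epsilon>\<^sup>2"
      using LINT_unit_power2_le[OF H2_tripleD(4)[OF d] est(1)] LINT_unit_power2_le[OF H2_tripleD(3)[OF d] est(2)]
      by (intro add_mono) auto
    also have "\<dots> = (\<alpha>\<^sup>2 + \<beta>\<^sup>2 + (2 * \<gamma>\<^sup>2 + 2) / \<epsilon>\<^sup>2) * \<eta>\<^sup>2"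
      by (simp add: power_mult_distrib distrib_right)
    finally have "sqrt ((LINT x|unit_meas. (V x - v x)\<^sup>2) + (LINT x|unit_meas. (G x - g x)\<^sup>2)
        + (LINT x|unit_meas. (H x - h x)\<^sup>2)) \<le> sqrt ((\<alpha>\<^sup>2 + \<beta>\<^sup>2 + (2 * \<gamma>\<^sup>2 + 2) / \<epsilon>\<^sup>2) * \<eta>\<^sup>2)"
      by (rule real_sqrt_le_mono)
    also have "\<dots> = C * \<eta>"
      using \<eta>pos by (simp add: C_def real_sqrt_mult)
    finally show ?thesis
      using H2_norm_triple[OF d, of "\<lambda>x. U x - v x"] ae by (auto elim: eventually_mono)
  qed
  moreover have "C \<ge> 0"
    by (simp add: C_def)
  ultimately show ?thesis
    using that pos by blast
qed

section \<open>Uniqueness of the solution and strong convergence of minimizing sequences\<close>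

theorem proposition4:
  fixes f :: "real \<Rightarrow> real" and \<epsilon> ul ur :: real
  assumes "\<epsilon> > 0" and "C2_fun f" and "ul > ur"
  shows "\<exists>u. solution f \<epsilon> ul ur u \<and>
             (\<forall>v. solution f \<epsilon> ul ur v \<longrightarrow> (AE x in unit_meas. v x = u x)) \<and>
             (\<forall>U. minimizing_seq (J f \<epsilon>) (H2_bdry ul ur) U \<longrightarrow>
                  (\<lambda>n. H2_norm (\<lambda>x. U n x - u x)) \<longlonglongrightarrow> 0)"
proof -
  obtain u g h k where t: "H2_triple u g h" and bdry: "u 0 = ul" "u 1 = ur"
    and flux: "\<And>x. x \<in> {0..1} \<Longrightarrow> f (u x) - \<epsilon> * g x = k"
    and res: "\<And>x. x \<in> {0..1} \<Longrightarrow> deriv f (u x) * g x - \<epsilon> * h x = 0"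
    using exists_stationary_triple[OF assms(3,1,2)] by blast
  have refl: "AE x in unit_meas. u x = u x"
    by simp
  note R = H2_triple_residual[OF t refl assms(2), of \<epsilon>]
  have mem: "u \<in> H2_bdry ul ur"
    using H2_triple_rep(1)[OF t refl] H2_triple_rep(2)[OF t refl, of 0] H2_triple_rep(2)[OF t refl, of 1] bdry
    by (simp add: H2_bdry_def)
  have sol: "solution f \<epsilon> ul ur u"
    unfolding solution_def
  proof (intro conjI mem)
    have "AE x in unit_meas. deriv f (u x) * g x - \<epsilon> * h x = 0"
      by (rule AE_I2) (use res in auto)
    then show "AE x in unit_meas. residual f \<epsilon> u x = 0"
      using R(2) by eventually_elim simp
  qed
  have J0: "J f \<epsilon> w = 0" if "solution f \<epsilon> ul ur w" for w
  proof -
    have "AE x in unit_meas. \<bar>residual f \<epsilon> w x\<bar>\<^sup>2 = 0"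
      using that unfolding solution_def by (auto elim: eventually_mono)
    then show ?thesis
      unfolding J_def by (subst integral_eq_zero_AE) auto
  qed
  obtain C \<eta>0 where C: "C \<ge> 0" "\<eta>0 > 0"
    and le: "\<And>U \<eta>. \<lbrakk>U \<in> H2_bdry ul ur; sqrt (2 * J f \<epsilon> U) < \<eta>; \<eta> \<le> \<eta>0\<rbrakk>
      \<Longrightarrow> H2_norm (\<lambda>x. U x - u x) \<le> C * \<eta>"
    using H2_norm_le_residual[OF assms(1,2) t flux res, unfolded bdry] by blast
  have uniq: "AE x in unit_meas. v x = u x" if v: "solution f \<epsilon> ul ur v" for v
  proof -
    have vH: "v \<in> H2_bdry ul ur"
      using v by (simp add: solution_def)
    then have "v \<in> H2"
      by (simp add: H2_bdry_def)
    then obtain V G H where t': "H2_triple V G H" and ae: "AE x in unit_meas. v x = V x"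
      using H2_obtain_triple by blast
    have "AE x in unit_meas. v x - u x = V x - u x"
      using ae by eventually_elim simp
    then have H2: "(\<lambda>x. v x - u x) \<in> H2"
      by (rule H2_triple_rep(1)[OF H2_triple_diff[OF t' t]])
    \<comment> \<open>A solution has J = 0, so the coercivity estimate holds for every small
      positive \<open>\<eta>\<close>; letting \<open>\<eta>\<close> tend to 0 makes the H^2 distance
      vanish.\<close>
    have "((\<lambda>\<eta>. C * \<eta>) \<longlongrightarrow> C * 0) (at_right 0)"
      by (intro tendsto_intros)
    moreover have "eventually (\<lambda>\<eta>. H2_norm (\<lambda>x. v x - u x) \<le> C * \<eta>) (at_right 0)"
      unfolding eventually_at_right_field
      by (rule exI[of _ \<eta>0]) (use le[OF vH] J0[OF v] C in auto)
    ultimately have "H2_norm (\<lambda>x. v x - u x) \<le> C * 0"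
      by (rule tendsto_lowerbound) simp
    then have "AE x in unit_meas. v x - u x = 0"
      using H2_norm_le_0_imp_AE_0[OF H2] by simp
    then show ?thesis
      by eventually_elim simp
  qed
  have "(\<lambda>n. H2_norm (\<lambda>x. U n x - u x)) \<longlonglongrightarrow> 0"
    if U: "minimizing_seq (J f \<epsilon>) (H2_bdry ul ur) U" for U
  proof -
    have Jnn: "J f \<epsilon> w \<ge> 0" for w
      by (simp add: J_def)
    \<comment> \<open>\<open>J\<close> is nonnegative and the profile attains 0, so along a
      minimizing sequence \<open>J\<close> tends to 0.\<close>
    have "(INF w\<in>H2_bdry ul ur. J f \<epsilon> w) = 0"
    proof (rule antisym)
      have "bdd_below (J f \<epsilon> ` H2_bdry ul ur)"
        using Jnn by (intro bdd_belowI[of _ 0]) auto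
      then show "(INF w\<in>H2_bdry ul ur. J f \<epsilon> w) \<le> 0"
        using cINF_lower[OF _ mem, of "J f \<epsilon>"] J0[OF sol] by simp
      show "0 \<le> (INF w\<in>H2_bdry ul ur. J f \<epsilon> w)"
        using mem Jnn by (intro cINF_greatest) auto
    qed
    then have "(\<lambda>n. J f \<epsilon> (U n)) \<longlonglongrightarrow> 0" and UH: "\<And>n. U n \<in> H2_bdry ul ur"
      using U by (auto simp: minimizing_seq_def)
    then have lim: "(\<lambda>n. sqrt (2 * J f \<epsilon> (U n))) \<longlonglongrightarrow> 0"
      using tendsto_real_sqrt[OF tendsto_mult[OF tendsto_const]] by fastforce
    \<comment> \<open>The added null sequence makes \<open>e n\<close> strictly larger than the
      residual norm, as the estimate demands, even when the latter is 0.\<close>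
    define e where "e n = sqrt (2 * J f \<epsilon> (U n)) + inverse (real (Suc n))" for n
    have e: "e \<longlonglongrightarrow> 0"
      unfolding e_def using tendsto_add[OF lim LIMSEQ_inverse_real_of_nat] by simp
    then have "eventually (\<lambda>n. e n < \<eta>0) sequentially"
      using C(2) by (rule order_tendstoD)
    then have "eventually (\<lambda>n. norm (H2_norm (\<lambda>x. U n x - u x)) \<le> C * e n) sequentially"
    proof eventually_elim
      case (elim n)
      have "H2_norm (\<lambda>x. U n x - u x) \<ge> 0"
        by (simp add: H2_norm_def)
      moreover have "H2_norm (\<lambda>x. U n x - u x) \<le> C * e n"
        using le[OF UH, of n "e n"] elim by (simp add: e_def)
      ultimately show ?case
        by simp
    qed
    moreover have "(\<lambda>n. C * e n) \<longlonglongrightarrow> 0"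
      using tendsto_mult[OF tendsto_const e, of C] by simp
    ultimately show ?thesis
      by (rule Lim_null_comparison)
  qed
  then show ?thesis
    using sol uniq by blast
qed

end
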